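(* The following are equivalent over $\mathsf{RCA}_0$. \begin{enumerate} \item $\mathsf{ACA}_0$. \item For every weak V-space $(X,\{\mathcal{W}_x : x \in X\})$, every set $Y$, every function $\pi : X \to Y$, and all $a,b \in X$: if $a$ and $b$ are connected in this V-space and $\pi(a) \neq \pi(b)$, then there exists an $x \in X$ such that $\pi$ is not constant on any vicinity $W \in \mathcal{W}_x$. \item For every strong V-space $(X,\{\mathcal{S}_x : x \in X\})$, every set $Y$, every function $\pi : X \to Y$, and all $a,b \in X$: if $a$ and $b$ are connected in this V-space and $\pi(a) \neq \pi(b)$, then there exists an $x \in X$ such that $\pi$ is not constant on any vicinity $S \in \mathcal{S}_x$. \end{enumerate}
   Context: $\mathsf{RCA}_0$ and $\mathsf{ACA}_0$ are the usual subsystems of second-order arithmetic (recursive comprehension and arithmetical comprehension). All notions below are formalized in the language of second-order arithmetic: $\omega$ denotes the set of natural numbers (of the model), all sets are subsets of it, and sequences of sets are coded by single sets in the usual way. Let $X$ be a non-empty subset of $\omega$. A weak system of vicinities for $x$ in $X$ is a sequence $\mathcal{W} = \langle W_n : n \in \omega\rangle$ such that $x \in W_n \subseteq X$ for all $n$. A weak V-space is a pair $(X,\{\mathcal{W}_x : x \in X\})$, where for each $x \in X$, $\mathcal{W}_x$ is a weak system of vicinities for $x$ in $X$ (the systems $\mathcal{W}_x$ being given together as a sequence indexed by $x \in X$). A strong system of vicinities for $x$ in $X$ is a sequence $\mathcal{S} = \langle S_n : n \in I\rangle$, where $I$ is a non-empty (possibly finite) initial segment of $\omega$, $x \in S_n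 \subseteq X$ for all $n \in I$, and $S_n \neq S_m$ for all $n,m \in I$ with $n \neq m$. A strong V-space is a pair $(X,\{\mathcal{S}_x : x \in X\})$, where for each $x \in X$, $\mathcal{S}_x$ is a strong system of vicinities for $x$ in $X$ (the systems $\mathcal{S}_x$, including their index sets, being given together as a sequence indexed by $x \in X$). In either case the members of the sequence $\mathcal{W}_x$ (respectively $\mathcal{S}_x$) are called the vicinities of $x$, and $W \in \mathcal{W}_x$ (respectively $S \in \mathcal{S}_x$) means that $W$ (respectively $S$) is a term of that sequence. A cover of a V-space is a sequence $\langle V_x : x \in X\rangle$ such that $V_x$ is a vicinity of $x$ for each $x \in X$. Two elements $a,b \in X$ are connected in the V-space if for every cover $\langle V_x : x \in X\rangle$ there is a finite sequence $x_0,\ldots,x_k$ of elements of $X$ such that $a = x_0$, $b = x_k$, and $V_{x_j} \cap V_{x_{j+1}} \neq \emptyset$ for each $j < k$. *)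

theory Defs
  imports Main
begin

text \<open>
  The language of second-order arithmetic, its (Henkin) structures, and the systems RCA$_0$
  and ACA$_0$, following Simpson, \<^emph>\<open>Subsystems of Second Order Arithmetic\<close>.

  The numbers of a structure form the whole type \<open>'n\<close>; the set variables range over the
  designated family \<open>Sets\<close> of subsets of it. Neither part need be standard. A statement is
  provable over RCA$_0$ iff it holds in every structure satisfying RCA$_0$, so ``over RCA$_0$'' is
  rendered as validity in all such structures.
\<close>

record 'n L2_structure =
  Zero :: 'n  (\<open>\<zero>\<index>\<close>)
  One  :: 'n  (\<open>\<one>\<index>\<close>)
  Plus :: "'n \<Rightarrow> 'n \<Rightarrow> 'n"  (infixl \<open>\<oplus>\<index>\<close> 65)
  Times :: "'n \<Rightarrow> 'n \<Rightarrow> 'n"  (infixl \<open>\<otimes>\<index>\<close> 70)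
  Less :: "'n \<Rightarrow> 'n \<Rightarrow> bool"  (infix \<open>\<prec>\<index>\<close> 50)
  Sets :: "'n set set"


subsection \<open>Formulas and satisfaction\<close>

text \<open>Number variables and set variables are two separate families, each named by \<^typ>\<open>nat\<close>.\<close>

datatype L2_term =
    Var nat
  | ZeroT
  | OneT
  | PlusT L2_term L2_term
  | TimesT L2_term L2_term

datatype L2_formula =
    Eq L2_term L2_term
  | Lt L2_term L2_term
  | Mem L2_term nat
  | Neg L2_formula
  | Conj L2_formula L2_formula
  | Disj L2_formula L2_formula
  | Imp L2_formula L2_formula
  | All nat L2_formula
  | Ex nat L2_formula
  | AllSet nat L2_formula
  | ExSet nat L2_formula

primrec term_vars :: "L2_term \<Rightarrow> nat set" where
  "term_vars (Var x) = {x}"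
| "term_vars ZeroT = {}"
| "term_vars OneT = {}"
| "term_vars (PlusT t u) = term_vars t \<union> term_vars u"
| "term_vars (TimesT t u) = term_vars t \<union> term_vars u"

primrec term_val :: "'n L2_structure \<Rightarrow> (nat \<Rightarrow> 'n) \<Rightarrow> L2_term \<Rightarrow> 'n" where
  "term_val M e (Var x) = e x"
| "term_val M e ZeroT = \<zero>\<^bsub>M\<^esub>"
| "term_val M e OneT = \<one>\<^bsub>M\<^esub>"
| "term_val M e (PlusT t u) = term_val M e t \<oplus>\<^bsub>M\<^esub> term_val M e u"
| "term_val M e (TimesT t u) = term_val M e t \<otimes>\<^bsub>M\<^esub> term_val M e u"

primrec sat :: "'n L2_structure \<Rightarrow> (nat \<Rightarrow> 'n) \<Rightarrow> (nat \<Rightarrow> 'n set) \<Rightarrow> L2_formula \<Rightarrow> bool" where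
  "sat M e s (Eq t u) \<longleftrightarrow> term_val M e t = term_val M e u"
| "sat M e s (Lt t u) \<longleftrightarrow> term_val M e t \<prec>\<^bsub>M\<^esub> term_val M e u"
| "sat M e s (Mem t A) \<longleftrightarrow> term_val M e t \<in> s A"
| "sat M e s (Neg \<phi>) \<longleftrightarrow> \<not> sat M e s \<phi>"
| "sat M e s (Conj \<phi> \<psi>) \<longleftrightarrow> sat M e s \<phi> \<and> sat M e s \<psi>"
| "sat M e s (Disj \<phi> \<psi>) \<longleftrightarrow> sat M e s \<phi> \<or> sat M e s \<psi>"
| "sat M e s (Imp \<phi> \<psi>) \<longleftrightarrow> (sat M e s \<phi> \<longrightarrow> sat M e s \<psi>)"
| "sat M e s (All x \<phi>) \<longleftrightarrow> (\<forall>n. sat M (e(x := n)) s \<phi>)"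
| "sat M e s (Ex x \<phi>) \<longleftrightarrow> (\<exists>n. sat M (e(x := n)) s \<phi>)"
| "sat M e s (AllSet A \<phi>) \<longleftrightarrow> (\<forall>Z\<in>Sets M. sat M e (s(A := Z)) \<phi>)"
| "sat M e s (ExSet A \<phi>) \<longleftrightarrow> (\<exists>Z\<in>Sets M. sat M e (s(A := Z)) \<phi>)"


subsection \<open>Formula classes\<close>

text \<open>Set variables may occur freely, as parameters, in all of these.\<close>

inductive bounded_formula :: "L2_formula \<Rightarrow> bool" where
  "bounded_formula (Eq t u)"
| "bounded_formula (Lt t u)"
| "bounded_formula (Mem t A)"
| "bounded_formula \<phi> \<Longrightarrow> bounded_formula (Neg \<phi>)"
| "bounded_formula \<phi> \<Longrightarrow> bounded_formula \<psi> \<Longrightarrow> bounded_formula (Conj \<phi> \<psi>)"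
| "bounded_formula \<phi> \<Longrightarrow> bounded_formula \<psi> \<Longrightarrow> bounded_formula (Disj \<phi> \<psi>)"
| "bounded_formula \<phi> \<Longrightarrow> bounded_formula \<psi> \<Longrightarrow> bounded_formula (Imp \<phi> \<psi>)"
| "bounded_formula \<phi> \<Longrightarrow> x \<notin> term_vars t \<Longrightarrow> bounded_formula (All x (Imp (Lt (Var x) t) \<phi>))"
| "bounded_formula \<phi> \<Longrightarrow> x \<notin> term_vars t \<Longrightarrow> bounded_formula (Ex x (Conj (Lt (Var x) t) \<phi>))"

definition sigma01 :: "L2_formula \<Rightarrow> bool" where
  "sigma01 \<phi> \<longleftrightarrow> (\<exists>x \<theta>. bounded_formula \<theta> \<and> \<phi> = Ex x \<theta>)"

definition pi01 :: "L2_formula \<Rightarrow> bool" where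
  "pi01 \<phi> \<longleftrightarrow> (\<exists>x \<theta>. bounded_formula \<theta> \<and> \<phi> = All x \<theta>)"

primrec arithmetical :: "L2_formula \<Rightarrow> bool" where
  "arithmetical (Eq t u) \<longleftrightarrow> True"
| "arithmetical (Lt t u) \<longleftrightarrow> True"
| "arithmetical (Mem t A) \<longleftrightarrow> True"
| "arithmetical (Neg \<phi>) \<longleftrightarrow> arithmetical \<phi>"
| "arithmetical (Conj \<phi> \<psi>) \<longleftrightarrow> arithmetical \<phi> \<and> arithmetical \<psi>"
| "arithmetical (Disj \<phi> \<psi>) \<longleftrightarrow> arithmetical \<phi> \<and> arithmetical \<psi>"
| "arithmetical (Imp \<phi> \<psi>) \<longleftrightarrow> arithmetical \<phi> \<and> arithmetical \<psi>"
| "arithmetical (All x \<phi>) \<longleftrightarrow> arithmetical \<phi>"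
| "arithmetical (Ex x \<phi>) \<longleftrightarrow> arithmetical \<phi>"
| "arithmetical (AllSet A \<phi>) \<longleftrightarrow> False"
| "arithmetical (ExSet A \<phi>) \<longleftrightarrow> False"


subsection \<open>The axiom systems\<close>

definition basic_axioms :: "'n L2_structure \<Rightarrow> bool" where
  "basic_axioms M \<longleftrightarrow>
     (\<forall>n. n \<oplus>\<^bsub>M\<^esub> \<one>\<^bsub>M\<^esub> \<noteq> \<zero>\<^bsub>M\<^esub>) \<and>
     (\<forall>m n. m \<oplus>\<^bsub>M\<^esub> \<one>\<^bsub>M\<^esub> = n \<oplus>\<^bsub>M\<^esub> \<one>\<^bsub>M\<^esub> \<longrightarrow> m = n) \<and>
     (\<forall>m. m \<oplus>\<^bsub>M\<^esub> \<zero>\<^bsub>M\<^esub> = m) \<and>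
     (\<forall>m n. m \<oplus>\<^bsub>M\<^esub> (n \<oplus>\<^bsub>M\<^esub> \<one>\<^bsub>M\<^esub>) = (m \<oplus>\<^bsub>M\<^esub> n) \<oplus>\<^bsub>M\<^esub> \<one>\<^bsub>M\<^esub>) \<and>
     (\<forall>m. m \<otimes>\<^bsub>M\<^esub> \<zero>\<^bsub>M\<^esub> = \<zero>\<^bsub>M\<^esub>) \<and>
     (\<forall>m n. m \<otimes>\<^bsub>M\<^esub> (n \<oplus>\<^bsub>M\<^esub> \<one>\<^bsub>M\<^esub>) = (m \<otimes>\<^bsub>M\<^esub> n) \<oplus>\<^bsub>M\<^esub> m) \<and>
     (\<forall>m. \<not> m \<prec>\<^bsub>M\<^esub> \<zero>\<^bsub>M\<^esub>) \<and>
     (\<forall>m n. m \<prec>\<^bsub>M\<^esub> n \<oplus>\<^bsub>M\<^esub> \<one>\<^bsub>M\<^esub> \<longleftrightarrow> m \<prec>\<^bsub>M\<^esub> n \<or> m = n)"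

text \<open>The schemes below are universally closed: \<open>e\<close> and \<open>s\<close> supply arbitrary parameters of the
  structure. In comprehension, evaluating \<open>\<phi>\<close> before the new set is chosen expresses that the
  new set variable is not free in \<open>\<phi>\<close>.\<close>

definition sigma01_induction :: "'n L2_structure \<Rightarrow> bool" where
  "sigma01_induction M \<longleftrightarrow>
     (\<forall>\<phi> x e s. sigma01 \<phi> \<longrightarrow> range s \<subseteq> Sets M \<longrightarrow>
        sat M (e(x := \<zero>\<^bsub>M\<^esub>)) s \<phi> \<longrightarrow>
        (\<forall>n. sat M (e(x := n)) s \<phi> \<longrightarrow> sat M (e(x := n \<oplus>\<^bsub>M\<^esub> \<one>\<^bsub>M\<^esub>)) s \<phi>) \<longrightarrow>
        (\<forall>n. sat M (e(x := n)) s \<phi>))"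

definition delta01_comprehension :: "'n L2_structure \<Rightarrow> bool" where
  "delta01_comprehension M \<longleftrightarrow>
     (\<forall>\<phi> \<psi> x e s. sigma01 \<phi> \<longrightarrow> pi01 \<psi> \<longrightarrow> range s \<subseteq> Sets M \<longrightarrow>
        (\<forall>n. sat M (e(x := n)) s \<phi> \<longleftrightarrow> sat M (e(x := n)) s \<psi>) \<longrightarrow>
        (\<exists>Z\<in>Sets M. \<forall>n. n \<in> Z \<longleftrightarrow> sat M (e(x := n)) s \<phi>))"

definition induction_axiom :: "'n L2_structure \<Rightarrow> bool" where
  "induction_axiom M \<longleftrightarrow>
     (\<forall>Z\<in>Sets M. \<zero>\<^bsub>M\<^esub> \<in> Z \<longrightarrow> (\<forall>n. n \<in> Z \<longrightarrow> n \<oplus>\<^bsub>M\<^esub> \<one>\<^bsub>M\<^esub> \<in> Z) \<longrightarrow> (\<forall>n. n \<in> Z))"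

definition arithmetical_comprehension :: "'n L2_structure \<Rightarrow> bool" where
  "arithmetical_comprehension M \<longleftrightarrow>
     (\<forall>\<phi> x e s. arithmetical \<phi> \<longrightarrow> range s \<subseteq> Sets M \<longrightarrow>
        (\<exists>Z\<in>Sets M. \<forall>n. n \<in> Z \<longleftrightarrow> sat M (e(x := n)) s \<phi>))"

text \<open>Both sorts of a structure are required to be non-empty; for numbers this is automatic.\<close>

definition RCA0 :: "'n L2_structure \<Rightarrow> bool" where
  "RCA0 M \<longleftrightarrow> Sets M \<noteq> {} \<and> basic_axioms M \<and> sigma01_induction M \<and> delta01_comprehension M"

definition ACA0 :: "'n L2_structure \<Rightarrow> bool" where
  "ACA0 M \<longleftrightarrow> Sets M \<noteq> {} \<and> basic_axioms M \<and> induction_axiom M \<and> arithmetical_comprehension M"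


subsection \<open>Coding inside a structure\<close>

text \<open>In everything that follows, number quantifiers range over \<open>'n\<close> and set quantifiers over
  \<open>Sets M\<close>, so each notion is the interpretation in \<open>M\<close> of a formula of the language.\<close>

text \<open>Simpson's pairing \<open>(i,j) = (i+j)\<^sup>2 + i\<close>.\<close>

definition pair_code :: "'n L2_structure \<Rightarrow> 'n \<Rightarrow> 'n \<Rightarrow> 'n" where
  "pair_code M i j = ((i \<oplus>\<^bsub>M\<^esub> j) \<otimes>\<^bsub>M\<^esub> (i \<oplus>\<^bsub>M\<^esub> j)) \<oplus>\<^bsub>M\<^esub> i"

text \<open>The \<open>n\<close>-th term of the sequence of sets coded by \<open>Z\<close>.\<close>

definition seq_term :: "'n L2_structure \<Rightarrow> 'n set \<Rightarrow> 'n \<Rightarrow> 'n set" where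
  "seq_term M Z n = {i. pair_code M i n \<in> Z}"

definition is_function :: "'n L2_structure \<Rightarrow> 'n set \<Rightarrow> 'n set \<Rightarrow> 'n set \<Rightarrow> bool" where
  "is_function M f X Y \<longleftrightarrow> f \<in> Sets M \<and>
     (\<forall>z\<in>f. \<exists>x\<in>X. \<exists>y\<in>Y. z = pair_code M x y) \<and>
     (\<forall>x\<in>X. \<exists>!y. pair_code M x y \<in> f)"

definition fun_app :: "'n L2_structure \<Rightarrow> 'n set \<Rightarrow> 'n \<Rightarrow> 'n" where
  "fun_app M f x = (THE y. pair_code M x y \<in> f)"

definition is_constant_on :: "'n L2_structure \<Rightarrow> 'n set \<Rightarrow> 'n set \<Rightarrow> bool" where
  "is_constant_on M f U \<longleftrightarrow> (\<forall>u\<in>U. \<forall>v\<in>U. fun_app M f u = fun_app M f v)"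

text \<open>A finite sequence is a finite (that is, bounded) set of the structure that is a function on
  \<open>{i. i < l}\<close>; its length \<open>l\<close> may be nonstandard.\<close>

definition finite_seq :: "'n L2_structure \<Rightarrow> 'n set \<Rightarrow> 'n \<Rightarrow> 'n set \<Rightarrow> bool" where
  "finite_seq M \<sigma> l X \<longleftrightarrow>
     is_function M \<sigma> {i. i \<prec>\<^bsub>M\<^esub> l} X \<and> (\<exists>b. \<forall>z\<in>\<sigma>. z \<prec>\<^bsub>M\<^esub> b)"


subsection \<open>V-spaces\<close>

text \<open>\<open>W\<close> codes the sequence indexed by \<open>x \<in> X\<close> whose \<open>x\<close>-th term codes in turn the
  sequence of vicinities of \<open>x\<close>. Its terms at \<open>x \<notin> X\<close> are irrelevant.\<close>

definition weak_V_space :: "'n L2_structure \<Rightarrow> 'n set \<Rightarrow> 'n set \<Rightarrow> bool" where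
  "weak_V_space M X W \<longleftrightarrow> X \<in> Sets M \<and> X \<noteq> {} \<and> W \<in> Sets M \<and>
     (\<forall>x\<in>X. \<forall>n. x \<in> seq_term M (seq_term M W x) n \<and> seq_term M (seq_term M W x) n \<subseteq> X)"

definition weak_vicinities :: "'n L2_structure \<Rightarrow> 'n set \<Rightarrow> 'n \<Rightarrow> 'n set set" where
  "weak_vicinities M W x = {seq_term M (seq_term M W x) n | n. True}"

definition initial_segment :: "'n L2_structure \<Rightarrow> 'n set \<Rightarrow> bool" where
  "initial_segment M I \<longleftrightarrow> (\<forall>n\<in>I. \<forall>m. m \<prec>\<^bsub>M\<^esub> n \<longrightarrow> m \<in> I)"

text \<open>\<open>J\<close> codes the sequence of index sets: its \<open>x\<close>-th term is the domain of the sequence of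
  vicinities of \<open>x\<close>. Terms of \<open>S\<close> at indices outside that domain are irrelevant.\<close>

definition strong_V_space :: "'n L2_structure \<Rightarrow> 'n set \<Rightarrow> 'n set \<Rightarrow> 'n set \<Rightarrow> bool" where
  "strong_V_space M X J S \<longleftrightarrow> X \<in> Sets M \<and> X \<noteq> {} \<and> J \<in> Sets M \<and> S \<in> Sets M \<and>
     (\<forall>x\<in>X. seq_term M J x \<noteq> {} \<and> initial_segment M (seq_term M J x) \<and>
       (\<forall>n\<in>seq_term M J x.
          x \<in> seq_term M (seq_term M S x) n \<and> seq_term M (seq_term M S x) n \<subseteq> X) \<and>
       (\<forall>n\<in>seq_term M J x. \<forall>m\<in>seq_term M J x. n \<noteq> m \<longrightarrow>
          seq_term M (seq_term M S x) n \<noteq> seq_term M (seq_term M S x) m))"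

definition strong_vicinities :: "'n L2_structure \<Rightarrow> 'n set \<Rightarrow> 'n set \<Rightarrow> 'n \<Rightarrow> 'n set set" where
  "strong_vicinities M J S x = {seq_term M (seq_term M S x) n | n. n \<in> seq_term M J x}"

text \<open>Covers and connectedness depend only on \<open>X\<close> and on the vicinities \<open>vic x\<close> of each
  \<open>x \<in> X\<close>, so they are defined once for both kinds of V-space. A cover is a sequence of sets; it
  does not come with a choice of indices for its terms.\<close>

definition V_cover :: "'n L2_structure \<Rightarrow> 'n set \<Rightarrow> ('n \<Rightarrow> 'n set set) \<Rightarrow> 'n set \<Rightarrow> bool" where
  "V_cover M X vic V \<longleftrightarrow> V \<in> Sets M \<and> (\<forall>x\<in>X. seq_term M V x \<in> vic x)"

definition V_connected ::
    "'n L2_structure \<Rightarrow> 'n set \<Rightarrow> ('n \<Rightarrow> 'n set set) \<Rightarrow> 'n \<Rightarrow> 'n \<Rightarrow> bool" where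
  "V_connected M X vic a b \<longleftrightarrow>
     (\<forall>V. V_cover M X vic V \<longrightarrow>
        (\<exists>k \<sigma>. finite_seq M \<sigma> (k \<oplus>\<^bsub>M\<^esub> \<one>\<^bsub>M\<^esub>) X \<and>
           a = fun_app M \<sigma> \<zero>\<^bsub>M\<^esub> \<and> b = fun_app M \<sigma> k \<and>
           (\<forall>j. j \<prec>\<^bsub>M\<^esub> k \<longrightarrow>
              seq_term M V (fun_app M \<sigma> j) \<inter>
              seq_term M V (fun_app M \<sigma> (j \<oplus>\<^bsub>M\<^esub> \<one>\<^bsub>M\<^esub>)) \<noteq> {})))"

end

theory Submission imports Defs begin

text \<open>
  Under ACA$_0$, if \<open>\<pi>\<close> is constant on some vicinity of every point, then choosing the first such
  vicinity of each point gives a cover, and \<open>\<pi>\<close> is constant along every chain of its members.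

  Conversely, ACA$_0$ holds as soon as the projection \<open>{n. \<exists>m. (n,m) \<in> T}\<close> of every set \<open>T\<close> exists.
  Given \<open>T\<close>, there is a V-space on which \<open>\<pi>\<close> takes two values, with a point \<open>x\<^sub>n\<close> for each \<open>n\<close>,
  whose vicinities are guesses about whether \<open>n\<close> is in the projection: a vicinity on which \<open>\<pi>\<close> is
  constant is a correct guess, and one on which it is not links the two fibres of \<open>\<pi>\<close>. As correct
  guesses exist, (2) or (3) provides a cover that separates the two fibres, and such a cover
  computes the projection.
\<close>

section \<open>Definability by bounded formulas\<close>

text \<open>Comprehension and induction are given for formulas with named variables, while the
  argument is about predicates. \<open>bounded_def\<close> bridges this: it holds of the predicates
  that a bounded formula defines with parameters from the structure, and it is proved by
  introduction rules. A projection turns an unbounded quantifier into a set parameter, so under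
  \<open>projection_closed\<close> every arithmetical predicate is bounded in this sense, and
  bounded comprehension already yields arithmetical comprehension.

  The obstacle in the reversal is that the V-space has to exist in RCA0: membership in a vicinity
  must be bounded, although membership of n in the projection is not. So the guess that n is outside
  does not ask whether a witness exists; each witness m contributes a point \<open>y\<^sub>m\<close>
  of its own, and to decide whether \<open>y\<^sub>m\<close> belongs it is enough to test (n,m)
  \<in> T. The only vicinity of \<open>y\<^sub>0\<close> is the whole fibre, so it meets every wrong
  guess, whatever the witness.\<close>

primrec rename_term :: "(nat \<Rightarrow> nat) \<Rightarrow> L2_term \<Rightarrow> L2_term" where
  "rename_term f (Var x) = Var (f x)"
| "rename_term f ZeroT = ZeroT"
| "rename_term f OneT = OneT"
| "rename_term f (PlusT t u) = PlusT (rename_term f t) (rename_term f u)"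
| "rename_term f (TimesT t u) = TimesT (rename_term f t) (rename_term f u)"

primrec rename :: "(nat \<Rightarrow> nat) \<Rightarrow> (nat \<Rightarrow> nat) \<Rightarrow> L2_formula \<Rightarrow> L2_formula" where
  "rename f g (Eq t u) = Eq (rename_term f t) (rename_term f u)"
| "rename f g (Lt t u) = Lt (rename_term f t) (rename_term f u)"
| "rename f g (Mem t A) = Mem (rename_term f t) (g A)"
| "rename f g (Neg \<phi>) = Neg (rename f g \<phi>)"
| "rename f g (Conj \<phi> \<psi>) = Conj (rename f g \<phi>) (rename f g \<psi>)"
| "rename f g (Disj \<phi> \<psi>) = Disj (rename f g \<phi>) (rename f g \<psi>)"
| "rename f g (Imp \<phi> \<psi>) = Imp (rename f g \<phi>) (rename f g \<psi>)"
| "rename f g (All x \<phi>) = All (f x) (rename f g \<phi>)"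
| "rename f g (Ex x \<phi>) = Ex (f x) (rename f g \<phi>)"
| "rename f g (AllSet A \<phi>) = AllSet (g A) (rename f g \<phi>)"
| "rename f g (ExSet A \<phi>) = ExSet (g A) (rename f g \<phi>)"

lemma term_val_rename: "term_val M e (rename_term f t) = term_val M (e \<circ> f) t"
  by (induction t) auto

lemma term_vars_rename: "term_vars (rename_term f t) = f ` term_vars t"
  by (induction t) auto

lemma fun_upd_comp_inj: "inj f \<Longrightarrow> e(f x := n) \<circ> f = (e \<circ> f)(x := n)"
  by (auto simp: fun_eq_iff inj_eq)

text \<open>Bound variables are renamed by the same maps as free ones, so injectivity alone excludes
  capture.\<close>

lemma sat_rename:
  assumes "inj f" "inj g"
  shows "sat M e s (rename f g \<phi>) \<longleftrightarrow> sat M (e \<circ> f) (s \<circ> g) \<phi>"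
  by (induction \<phi> arbitrary: e s) (auto simp: term_val_rename fun_upd_comp_inj assms)

lemma bounded_rename:
  assumes "bounded_formula \<phi>" "inj f"
  shows "bounded_formula (rename f g \<phi>)"
  using assms(1)
  by induction (auto intro!: bounded_formula.intros simp: term_vars_rename inj_eq[OF assms(2)])

section \<open>Dependence on finitely many number variables\<close>

definition finite_support :: "((nat \<Rightarrow> 'a) \<Rightarrow> 'b) \<Rightarrow> bool" where
  "finite_support F \<longleftrightarrow> (\<exists>N. \<forall>e e'. (\<forall>i<N. e i = e' i) \<longrightarrow> F e = F e')"

lemma finite_support_const: "finite_support (\<lambda>e. c)"
  by (auto simp: finite_support_def)

lemma finite_support_var: "finite_support (\<lambda>e. e x)"
  unfolding finite_support_def by (rule exI[of _ "Suc x"]) simp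

lemma finite_support_compose: "finite_support F \<Longrightarrow> finite_support (\<lambda>e. h (F e))"
  unfolding finite_support_def by metis

lemma finite_support_compose2:
  assumes "finite_support F" "finite_support G"
  shows "finite_support (\<lambda>e. h (F e) (G e))"
proof -
  obtain N1 N2 where
    N1: "\<And>e e'. (\<forall>i<N1. e i = e' i) \<Longrightarrow> F e = F e'" and
    N2: "\<And>e e'. (\<forall>i<N2. e i = e' i) \<Longrightarrow> G e = G e'"
    using assms unfolding finite_support_def by blast
  have "h (F e) (G e) = h (F e') (G e')" if "\<forall>i<max N1 N2. e i = e' i" for e e'
    using N1[of e e'] N2[of e e'] that by simp
  then show ?thesis unfolding finite_support_def by blast
qed

lemma finite_support_bind:
  assumes "finite_support F"
  shows "finite_support (\<lambda>e. h (\<lambda>n. F (e(x := n))))"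
proof -
  obtain N where N: "\<And>e e'. (\<forall>i<N. e i = e' i) \<Longrightarrow> F e = F e'"
    using assms unfolding finite_support_def by blast
  have "h (\<lambda>n. F (e(x := n))) = h (\<lambda>n. F (e'(x := n)))" if "\<forall>i<N. e i = e' i" for e e'
    by (rule arg_cong[of _ _ h], intro ext N) (simp add: that)
  then show ?thesis unfolding finite_support_def by blast
qed

lemma finite_support_term_val: "finite_support (\<lambda>e. term_val M e t)"
  by (induction t)
     (auto intro: finite_support_const finite_support_var finite_support_compose2)

text \<open>Satisfaction is read as a function of \<open>e\<close> whose value is a predicate of
  \<open>s\<close>: one bound on the number variables must serve all set assignments, since set
  quantifiers change \<open>s\<close>. The bound becomes the measure of the induction in
  \<open>projection_exists_aux\<close>.\<close>

lemma finite_support_sat: "finite_support (\<lambda>e s. sat M e s \<phi>)"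
proof (induction \<phi>)
  case (Eq t u)
  show ?case
    using finite_support_compose2[OF finite_support_term_val[of M t] finite_support_term_val[of M u],
        where h = "\<lambda>a b s. a = b"] by simp
next
  case (Lt t u)
  show ?case
    using finite_support_compose2[OF finite_support_term_val[of M t] finite_support_term_val[of M u],
        where h = "\<lambda>a b s. a \<prec>\<^bsub>M\<^esub> b"] by simp
next
  case (Mem t A)
  show ?case
    using finite_support_compose[OF finite_support_term_val[of M t], where h = "\<lambda>a s. a \<in> s A"]
    by simp
next
  case (Neg \<phi>)
  show ?case using finite_support_compose[OF Neg, where h = "\<lambda>f s. \<not> f s"] by simp
next
  case (Conj \<phi> \<psi>)
  show ?case using finite_support_compose2[OF Conj, where h = "\<lambda>f g s. f s \<and> g s"] by simp
next
  case (Disj \<phi> \<psi>)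
  show ?case using finite_support_compose2[OF Disj, where h = "\<lambda>f g s. f s \<or> g s"] by simp
next
  case (Imp \<phi> \<psi>)
  show ?case using finite_support_compose2[OF Imp, where h = "\<lambda>f g s. f s \<longrightarrow> g s"] by simp
next
  case (All x \<phi>)
  show ?case using finite_support_bind[OF All, where h = "\<lambda>f s. \<forall>n. f n s"] by (simp only: sat.simps)
next
  case (Ex x \<phi>)
  show ?case using finite_support_bind[OF Ex, where h = "\<lambda>f s. \<exists>n. f n s"] by (simp only: sat.simps)
next
  case (AllSet A \<phi>)
  show ?case
    using finite_support_compose[OF AllSet, where h = "\<lambda>f s. \<forall>Z\<in>Sets M. f (s(A := Z))"] by (simp only: sat.simps)
next
  case (ExSet A \<phi>)
  show ?case
    using finite_support_compose[OF ExSet, where h = "\<lambda>f s. \<exists>Z\<in>Sets M. f (s(A := Z))"] by (simp only: sat.simps)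
qed

section \<open>Assignments split into arguments and parameters\<close>

definition interleave :: "(nat \<Rightarrow> 'a) \<Rightarrow> (nat \<Rightarrow> 'a) \<Rightarrow> nat \<Rightarrow> 'a" where
  "interleave a b i = (if even i then a (i div 2) else b (i div 2))"

lemma interleave_simps [simp]:
  "interleave a b (2 * i) = a i" "interleave a b (Suc (2 * i)) = b i"
  by (auto simp: interleave_def)

lemma nat_parity_cases:
  fixes i :: nat
  obtains j where "i = 2 * j" | j where "i = Suc (2 * j)"
  by (metis evenE oddE Suc_eq_plus1)

lemma ext_parity:
  assumes "\<And>i. f (2 * i) = g (2 * i)" "\<And>i. f (Suc (2 * i)) = g (Suc (2 * i))"
  shows "f = g"
  by (rule ext) (metis nat_parity_cases assms)

lemma inj_interleave:
  assumes "inj a" "inj b" "\<And>i j. a i \<noteq> b j"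
  shows "inj (interleave a b)"
proof (rule injI)
  fix x y assume "interleave a b x = interleave a b y"
  then show "x = y" using assms
    by (cases x rule: nat_parity_cases; cases y rule: nat_parity_cases)
       (auto simp: inj_eq dest!: sym[of "b _" "a _"])
qed

text \<open>Even variables hold the arguments, odd variables hold number parameters, which can thus be
  supplied without changing the arguments.\<close>

definition term_in :: "'n L2_structure \<Rightarrow> (nat \<Rightarrow> 'n) \<Rightarrow> ((nat \<Rightarrow> 'n) \<Rightarrow> 'n) \<Rightarrow> bool" where
  "term_in M p t \<longleftrightarrow> (\<exists>\<tau>. \<forall>e. t e = term_val M (interleave e p) \<tau>)"

definition bounded_in ::
    "'n L2_structure \<Rightarrow> (nat \<Rightarrow> 'n) \<Rightarrow> (nat \<Rightarrow> 'n set) \<Rightarrow> ((nat \<Rightarrow> 'n) \<Rightarrow> bool) \<Rightarrow> bool" where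
  "bounded_in M p s P \<longleftrightarrow>
     (\<exists>\<theta>. bounded_formula \<theta> \<and> (\<forall>e. P e \<longleftrightarrow> sat M (interleave e p) s \<theta>))"

definition term_def :: "'n L2_structure \<Rightarrow> ((nat \<Rightarrow> 'n) \<Rightarrow> 'n) \<Rightarrow> bool" where
  "term_def M t \<longleftrightarrow> (\<exists>p. term_in M p t)"

definition bounded_def :: "'n L2_structure \<Rightarrow> ((nat \<Rightarrow> 'n) \<Rightarrow> bool) \<Rightarrow> bool" where
  "bounded_def M P \<longleftrightarrow> (\<exists>p s. range s \<subseteq> Sets M \<and> bounded_in M p s P)"

text \<open>These renamings fix the arguments and send parameter j to its place in a merged
  parameter sequence. They give two formulas with different parameters a common list.\<close>

lemma interleave_comp_interleave:
  "interleave e (interleave p q) \<circ> interleave (\<lambda>i. 2 * i) (\<lambda>j. Suc (2 * (2 * j))) = interleave e p"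
  "interleave e (interleave p q) \<circ> interleave (\<lambda>i. 2 * i) (\<lambda>j. Suc (2 * Suc (2 * j)))
     = interleave e q"
  by (rule ext_parity; simp only: comp_apply interleave_simps)+

lemma even_neq_odd: "2 * i \<noteq> Suc (2 * j)"
  by presburger

lemma inj_param:
  "inj (interleave (\<lambda>i. 2 * i) (\<lambda>j. Suc (2 * (2 * j))) :: nat \<Rightarrow> nat)"
  "inj (interleave (\<lambda>i. 2 * i) (\<lambda>j. Suc (2 * Suc (2 * j))) :: nat \<Rightarrow> nat)"
  by (rule inj_interleave; (rule even_neq_odd | simp add: inj_def))+

lemma term_in_interleave:
  assumes "term_in M p t"
  shows "term_in M (interleave p q) t" "term_in M (interleave q p) t"
  using assms unfolding term_in_def
  by (metis term_val_rename interleave_comp_interleave)+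

lemma bounded_in_interleave:
  assumes "bounded_in M p s P"
  shows "bounded_in M (interleave p q) (interleave s r) P"
    "bounded_in M (interleave q p) (interleave r s) P"
proof -
  obtain \<theta> where \<theta>: "bounded_formula \<theta>" "\<And>e. P e \<longleftrightarrow> sat M (interleave e p) s \<theta>"
    using assms by (auto simp: bounded_in_def)
  have g: "interleave s r \<circ> (\<lambda>i. 2 * i) = s" "interleave r s \<circ> (\<lambda>i. Suc (2 * i)) = s"
    "inj (\<lambda>i::nat. 2 * i)" "inj (\<lambda>i::nat. Suc (2 * i))"
    by (auto simp: fun_eq_iff inj_def)
  show "bounded_in M (interleave p q) (interleave s r) P"
    unfolding bounded_in_def
    by (intro exI conjI allI, rule bounded_rename[OF \<theta>(1) inj_param(1)],
        subst sat_rename[OF inj_param(1) g(3)], simp only: \<theta>(2) interleave_comp_interleave g)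
  show "bounded_in M (interleave q p) (interleave r s) P"
    unfolding bounded_in_def
    by (intro exI conjI allI, rule bounded_rename[OF \<theta>(1) inj_param(2)],
        subst sat_rename[OF inj_param(2) g(4)], simp only: \<theta>(2) interleave_comp_interleave g)
qed

lemma bounded_in_merge:
  assumes "bounded_def M P" "bounded_def M Q"
  obtains p s where "range s \<subseteq> Sets M" "bounded_in M p s P" "bounded_in M p s Q"
proof -
  obtain p s q r where *: "range s \<subseteq> Sets M" "bounded_in M p s P"
    "range r \<subseteq> Sets M" "bounded_in M q r Q"
    using assms by (auto simp: bounded_def_def)
  have "range (interleave s r) \<subseteq> Sets M"
    using * by (auto simp: interleave_def)
  with * show ?thesis using that bounded_in_interleave by metis
qed

lemma term_in_merge:
  assumes "term_def M t" "term_def M u"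
  obtains p where "term_in M p t" "term_in M p u"
  using assms term_in_interleave unfolding term_def_def by metis

lemma term_bounded_in_merge:
  assumes "term_def M t" "bounded_def M P"
  obtains p s where "range s \<subseteq> Sets M" "term_in M p t" "bounded_in M p s P"
proof -
  obtain p s q where *: "range s \<subseteq> Sets M" "bounded_in M p s P" "term_in M q t"
    using assms by (auto simp: bounded_def_def term_def_def)
  have "range (interleave s s) \<subseteq> Sets M"
    using * by (auto simp: interleave_def)
  with * show ?thesis using that bounded_in_interleave term_in_interleave by metis
qed

text \<open>Both renamings leave room for one more parameter, variable 1. A bounded quantifier binds that
  variable, which takes the place of argument 0 under \<open>bind_param\<close>; under \<open>skip_param\<close> it is a dummy.\<close>

definition skip_param :: "nat \<Rightarrow> nat" where
  "skip_param = interleave (\<lambda>i. 2 * i) (\<lambda>j. Suc (2 * Suc j))"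

definition bind_param :: "nat \<Rightarrow> nat" where
  "bind_param = interleave (case_nat 1 (\<lambda>i. 2 * i)) (\<lambda>j. Suc (2 * Suc j))"

lemma inj_skip_param: "inj skip_param"
  unfolding skip_param_def by (rule inj_interleave; (rule even_neq_odd | simp add: inj_def))

lemma inj_case_nat: "inj f \<Longrightarrow> a \<notin> range f \<Longrightarrow> inj (case_nat a f)"
  by (rule injI) (auto simp: inj_eq split: nat.splits)

lemma inj_bind_param: "inj bind_param"
  unfolding bind_param_def
proof (rule inj_interleave)
  show "inj (case_nat 1 (\<lambda>i. 2 * i))"
    by (rule inj_case_nat) (auto simp: inj_def)
  show "case_nat 1 (\<lambda>i. 2 * i) i \<noteq> Suc (2 * Suc j)" for i j
    by (cases i) (simp, simp, presburger)
qed (simp add: inj_def)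

lemma interleave_comp_skip_param:
  "(interleave e (case_nat c p))(Suc 0 := v) \<circ> skip_param = interleave e p"
  unfolding skip_param_def
  by (rule ext_parity; simp only: comp_apply interleave_simps fun_upd_apply even_neq_odd; simp)

lemma interleave_comp_bind_param:
  "(interleave e (case_nat c p))(Suc 0 := v) \<circ> bind_param = interleave (case_nat v e) p"
proof (rule ext_parity)
  fix i
  show "((interleave e (case_nat c p))(Suc 0 := v) \<circ> bind_param) (2 * i)
      = interleave (case_nat v e) p (2 * i)"
    unfolding bind_param_def comp_apply interleave_simps by (cases i) (auto simp: even_neq_odd)
next
  fix i
  show "((interleave e (case_nat c p))(Suc 0 := v) \<circ> bind_param) (Suc (2 * i))
      = interleave (case_nat v e) p (Suc (2 * i))"
    unfolding bind_param_def comp_apply interleave_simps fun_upd_apply by simp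
qed

text \<open>The term will bound a quantifier over variable 1, and bounded formulas forbid the bound
  variable in the bound. The old content \<open>c\<close> of that variable is overwritten by
  \<open>v\<close>.\<close>

lemma term_in_skip:
  assumes "term_in M p t"
  obtains \<tau> where "Suc 0 \<notin> term_vars \<tau>"
    "\<And>e c v. t e = term_val M ((interleave e (case_nat c p))(Suc 0 := v)) \<tau>"
proof -
  obtain \<tau> where "\<And>e. t e = term_val M (interleave e p) \<tau>"
    using assms by (auto simp: term_in_def)
  moreover have "Suc 0 \<notin> range skip_param"
    unfolding skip_param_def
    by (auto simp: interleave_def split: if_splits)
  ultimately show ?thesis
    by (intro that[of "rename_term skip_param \<tau>"])
       (auto simp: term_vars_rename term_val_rename interleave_comp_skip_param)
qed

lemma bounded_in_skip:
  assumes "bounded_in M p s P"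
  obtains \<theta> where "bounded_formula \<theta>"
    "\<And>e c v. P e \<longleftrightarrow> sat M ((interleave e (case_nat c p))(Suc 0 := v)) s \<theta>"
proof -
  obtain \<theta> where "bounded_formula \<theta>" "\<And>e. P e \<longleftrightarrow> sat M (interleave e p) s \<theta>"
    using assms by (auto simp: bounded_in_def)
  then show ?thesis
    by (intro that[of "rename skip_param id \<theta>"])
       (auto simp: bounded_rename sat_rename interleave_comp_skip_param inj_skip_param)
qed

lemma bounded_in_bind:
  assumes "bounded_in M p s (\<lambda>e. P (e 0) (\<lambda>i. e (Suc i)))"
  obtains \<theta> where "bounded_formula \<theta>"
    "\<And>e c v. P v e \<longleftrightarrow> sat M ((interleave e (case_nat c p))(Suc 0 := v)) s \<theta>"
proof -
  obtain \<theta> where \<theta>: "bounded_formula \<theta>"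
    "\<And>e. P (e 0) (\<lambda>i. e (Suc i)) \<longleftrightarrow> sat M (interleave e p) s \<theta>"
    using assms by (auto simp: bounded_in_def)
  have "P v e \<longleftrightarrow> sat M (interleave (case_nat v e) p) s \<theta>" for v e
    using \<theta>(2)[of "case_nat v e"] by simp
  then show ?thesis
    by (intro that[of "rename bind_param id \<theta>"])
       (auto simp: \<theta>(1) bounded_rename sat_rename interleave_comp_bind_param inj_bind_param)
qed

lemma interleave_fun_upd: "(interleave e p)(2 * x := n) = interleave (e(x := n)) p"
  by (auto simp: interleave_def fun_eq_iff)

section \<open>Closure properties of definable terms and predicates\<close>

lemma term_def_var: "term_def M (\<lambda>e. e i)"
  unfolding term_def_def term_in_def by (intro exI[of _ undefined] exI[of _ "Var (2 * i)"]) simp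

lemma term_def_const: "term_def M (\<lambda>e. c)"
  unfolding term_def_def term_in_def
  \<comment> \<open>Variable 1 is the first parameter; it is written as \<open>Suc (2 * 0)\<close>
    to match \<open>interleave_simps\<close>.\<close>
  by (intro exI[of _ "\<lambda>_. c"] exI[of _ "Var (Suc (2 * 0))"] allI)
     (simp only: term_val.simps interleave_simps)

lemma term_def_plus:
  assumes "term_def M t" "term_def M u"
  shows "term_def M (\<lambda>e. t e \<oplus>\<^bsub>M\<^esub> u e)"
  using term_in_merge[OF assms] unfolding term_in_def term_def_def by (metis term_val.simps(4))

lemma term_def_times:
  assumes "term_def M t" "term_def M u"
  shows "term_def M (\<lambda>e. t e \<otimes>\<^bsub>M\<^esub> u e)"
  using term_in_merge[OF assms] unfolding term_in_def term_def_def by (metis term_val.simps(5))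

lemma term_def_pair_code:
  assumes "term_def M t" "term_def M u"
  shows "term_def M (\<lambda>e. pair_code M (t e) (u e))"
  unfolding pair_code_def by (intro term_def_plus term_def_times assms)

lemmas term_intros =
  term_def_const term_def_var term_def_plus term_def_times term_def_pair_code

lemma bounded_def_mem:
  assumes "A \<in> Sets M" "term_def M t"
  shows "bounded_def M (\<lambda>e. t e \<in> A)"
proof -
  obtain p \<tau> where \<tau>: "\<And>e. t e = term_val M (interleave e p) \<tau>"
    using assms by (auto simp: term_def_def term_in_def)
  show ?thesis
    unfolding bounded_def_def bounded_in_def
    by (intro exI[of _ p] exI[of _ "\<lambda>_. A"] conjI exI[of _ "Mem \<tau> 0"])
       (auto simp: \<tau> assms intro: bounded_formula.intros)
qed

lemma bounded_def_not:
  assumes "bounded_def M P"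
  shows "bounded_def M (\<lambda>e. \<not> P e)"
  using assms unfolding bounded_def_def bounded_in_def
  by (metis bounded_formula.intros(4) sat.simps(4))

lemma bounded_def_conj:
  assumes "bounded_def M P" "bounded_def M Q"
  shows "bounded_def M (\<lambda>e. P e \<and> Q e)"
  by (rule bounded_in_merge[OF assms]; unfold bounded_def_def bounded_in_def)
     (metis bounded_formula.intros(5) sat.simps(5))

lemma bounded_def_disj:
  assumes "bounded_def M P" "bounded_def M Q"
  shows "bounded_def M (\<lambda>e. P e \<or> Q e)"
  using bounded_def_not[OF bounded_def_conj[OF assms[THEN bounded_def_not]]] by simp

lemma bounded_def_imp:
  assumes "bounded_def M P" "bounded_def M Q"
  shows "bounded_def M (\<lambda>e. P e \<longrightarrow> Q e)"
  using bounded_def_disj[OF bounded_def_not[OF assms(1)] assms(2)] by (simp only: imp_conv_disj)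

text \<open>In the quantifier rules the bound variable becomes argument 0 and the others move up by one, so
  they apply without freshness conditions.\<close>

lemma bounded_def_bex:
  assumes "term_def M t" "bounded_def M (\<lambda>e. P (e 0) (\<lambda>i. e (Suc i)))"
  shows "bounded_def M (\<lambda>e. \<exists>v. v \<prec>\<^bsub>M\<^esub> t e \<and> P v e)"
proof -
  obtain p s where s: "range s \<subseteq> Sets M" and p: "term_in M p t"
    "bounded_in M p s (\<lambda>e. P (e 0) (\<lambda>i. e (Suc i)))"
    using term_bounded_in_merge[OF assms] by blast
  obtain \<tau> where \<tau>: "Suc 0 \<notin> term_vars \<tau>"
    "\<And>e c v. t e = term_val M ((interleave e (case_nat c p))(Suc 0 := v)) \<tau>"
    using term_in_skip[OF p(1)] by blast
  obtain \<theta> where \<theta>: "bounded_formula \<theta>"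
    "\<And>e c v. P v e \<longleftrightarrow> sat M ((interleave e (case_nat c p))(Suc 0 := v)) s \<theta>"
    using bounded_in_bind[OF p(2)] by blast
  let ?\<phi> = "Ex (Suc 0) (Conj (Lt (Var (Suc 0)) \<tau>) \<theta>)"
  have "bounded_formula ?\<phi>" by (intro bounded_formula.intros \<theta> \<tau>)
  \<comment> \<open>\<open>p 0\<close> is an arbitrary filler for variable 1, which the quantifier
    overwrites.\<close>
  moreover have "(\<exists>v. v \<prec>\<^bsub>M\<^esub> t e \<and> P v e) \<longleftrightarrow> sat M (interleave e (case_nat (p 0) p)) s ?\<phi>" for e
    unfolding sat.simps \<tau>(2)[of e "p 0", symmetric] \<theta>(2)[of _ e "p 0", symmetric] by simp
  ultimately show ?thesis using s unfolding bounded_def_def bounded_in_def by blast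
qed

lemma bounded_def_ball:
  assumes "term_def M t" "bounded_def M (\<lambda>e. P (e 0) (\<lambda>i. e (Suc i)))"
  shows "bounded_def M (\<lambda>e. \<forall>v. v \<prec>\<^bsub>M\<^esub> t e \<longrightarrow> P v e)"
  using bounded_def_not[OF bounded_def_bex[OF assms(1), of "\<lambda>v e. \<not> P v e"]]
    bounded_def_not[OF assms(2)] by simp

text \<open>The quantifier rules dictate which argument is bound; this moves arguments to the
  positions they expect.\<close>

lemma bounded_def_reindex:
  assumes "bounded_def M P" "inj h"
  shows "bounded_def M (\<lambda>e. P (\<lambda>i. e (h i)))"
proof -
  obtain p s \<theta> where s: "range s \<subseteq> Sets M" and \<theta>: "bounded_formula \<theta>"
    "\<And>e. P e \<longleftrightarrow> sat M (interleave e p) s \<theta>"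
    using assms(1) by (auto simp: bounded_def_def bounded_in_def)
  let ?f = "interleave (\<lambda>i. 2 * h i) (\<lambda>i. Suc (2 * i))"
  have f: "inj ?f"
    by (rule inj_interleave; (rule even_neq_odd | use assms(2) in \<open>simp add: inj_def\<close>))
  have "interleave e p \<circ> ?f = interleave (\<lambda>i. e (h i)) p" for e
    by (rule ext_parity) (simp_all only: comp_apply interleave_simps)
  then have "P (\<lambda>i. e (h i)) \<longleftrightarrow> sat M (interleave e p) s (rename ?f id \<theta>)" for e
    by (simp add: \<theta>(2) sat_rename[OF f])
  then show ?thesis
    using s bounded_rename[OF \<theta>(1) f] unfolding bounded_def_def bounded_in_def by blast
qed

lemma bounded_def_finite_support:
  assumes "bounded_def M P"
  shows "finite_support P"
proof -
  obtain p s \<theta> where \<theta>: "\<And>e. P e \<longleftrightarrow> sat M (interleave e p) s \<theta>"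
    using assms by (auto simp: bounded_def_def bounded_in_def)
  obtain N where N: "\<And>e e'. (\<forall>i<N. e i = e' i) \<Longrightarrow> sat M e s \<theta> = sat M e' s \<theta>"
    using finite_support_sat[of M \<theta>] unfolding finite_support_def fun_eq_iff by blast
  have "P e = P e'" if "\<forall>i<N. e i = e' i" for e e'
    unfolding \<theta> using that by (intro N) (auto simp: interleave_def)
  then show ?thesis unfolding finite_support_def by blast
qed

section \<open>Comprehension and induction for definable predicates\<close>

locale rca0 =
  fixes M :: "'n L2_structure" (structure)
  assumes rca0: "RCA0 M"
begin

text \<open>The language has no formula for truth or falsity, so a tautology and a contradiction
  about a set of the structure take their place.\<close>

lemma bounded_def_const: "bounded_def M (\<lambda>e. c)"
proof -
  obtain A where "A \<in> Sets M" using rca0 by (auto simp: RCA0_def)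
  then have "bounded_def M (\<lambda>e. e 0 \<in> A)" by (intro bounded_def_mem term_intros)
  then have "bounded_def M (\<lambda>e. e 0 \<in> A \<or> \<not> e 0 \<in> A)" "bounded_def M (\<lambda>e. e 0 \<in> A \<and> \<not> e 0 \<in> A)"
    by (intro bounded_def_disj bounded_def_conj bounded_def_not; assumption)+
  then show ?thesis by (cases c) simp_all
qed

lemma bounded_def_eq:
  assumes "term_def M t" "term_def M u"
  shows "bounded_def M (\<lambda>e. t e = u e)"
proof -
  obtain A where A: "A \<in> Sets M" using rca0 by (auto simp: RCA0_def)
  obtain p \<tau> \<upsilon> where "\<And>e. t e = term_val M (interleave e p) \<tau>" "\<And>e. u e = term_val M (interleave e p) \<upsilon>"
    using term_in_merge[OF assms] unfolding term_in_def by metis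
  then show ?thesis
    unfolding bounded_def_def bounded_in_def using A
    by (intro exI[of _ p] exI[of _ "\<lambda>_. A"] conjI exI[of _ "Eq \<tau> \<upsilon>"])
       (auto intro: bounded_formula.intros)
qed

lemma bounded_def_less:
  assumes "term_def M t" "term_def M u"
  shows "bounded_def M (\<lambda>e. t e \<prec> u e)"
proof -
  obtain A where A: "A \<in> Sets M" using rca0 by (auto simp: RCA0_def)
  obtain p \<tau> \<upsilon> where "\<And>e. t e = term_val M (interleave e p) \<tau>" "\<And>e. u e = term_val M (interleave e p) \<upsilon>"
    using term_in_merge[OF assms] unfolding term_in_def by metis
  then show ?thesis
    unfolding bounded_def_def bounded_in_def using A
    by (intro exI[of _ p] exI[of _ "\<lambda>_. A"] conjI exI[of _ "Lt \<tau> \<upsilon>"])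
       (auto intro: bounded_formula.intros)
qed

lemmas bounded_intros =
  bounded_def_const bounded_def_eq bounded_def_less bounded_def_mem bounded_def_not
  bounded_def_conj bounded_def_disj bounded_def_imp bounded_def_bex bounded_def_ball

text \<open>Quantifying the dummy variable 1, existentially or universally, makes the same bounded
  formula both \<open>sigma01\<close> and \<open>pi01\<close>.\<close>

lemma bounded_comprehension:
  assumes "bounded_def M P"
  shows "\<exists>Z\<in>Sets M. \<forall>n. n \<in> Z \<longleftrightarrow> P (e(x := n))"
proof -
  obtain p s where s: "range s \<subseteq> Sets M" and p: "bounded_in M p s P"
    using assms by (auto simp: bounded_def_def)
  obtain \<theta> where \<theta>: "bounded_formula \<theta>"
    "\<And>e c v. P e \<longleftrightarrow> sat M ((interleave e (case_nat c p))(Suc 0 := v)) s \<theta>"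
    using bounded_in_skip[OF p] by blast
  define E where "E = interleave e (case_nat (p 0) p)"
  have P: "P (e(x := n)) \<longleftrightarrow> sat M (E(2 * x := n, Suc 0 := v)) s \<theta>" for n v
    unfolding E_def interleave_fun_upd by (rule \<theta>(2))
  have "sigma01 (Ex (Suc 0) \<theta>)" "pi01 (All (Suc 0) \<theta>)"
    using \<theta>(1) by (auto simp: sigma01_def pi01_def)
  moreover have ex: "sat M (E(2 * x := n)) s (Ex (Suc 0) \<theta>) \<longleftrightarrow> P (e(x := n))"
    and "sat M (E(2 * x := n)) s (All (Suc 0) \<theta>) \<longleftrightarrow> P (e(x := n))" for n
    unfolding sat.simps P[of n, symmetric] by simp_all
  ultimately have "\<exists>Z\<in>Sets M. \<forall>n. n \<in> Z \<longleftrightarrow> sat M (E(2 * x := n)) s (Ex (Suc 0) \<theta>)"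
    using s rca0 unfolding RCA0_def delta01_comprehension_def by blast
  then show ?thesis unfolding ex .
qed

lemma bounded_comprehension1:
  assumes "bounded_def M (\<lambda>e. P (e 0))"
  obtains Z where "Z \<in> Sets M" "\<And>n. n \<in> Z \<longleftrightarrow> P n"
  using bounded_comprehension[OF assms, of undefined 0] by auto

text \<open>A dummy existential quantifier turns the bounded formula into an instance of
  \<open>sigma01_induction\<close>.\<close>

lemma bounded_induct [case_names definable zero suc]:
  assumes "bounded_def M (\<lambda>e. P (e 0))"
    and "P \<zero>" and "\<And>n. P n \<Longrightarrow> P (n \<oplus> \<one>)"
  shows "P n"
proof -
  obtain p s where s: "range s \<subseteq> Sets M" and p: "bounded_in M p s (\<lambda>e. P (e 0))"
    using assms(1) by (auto simp: bounded_def_def)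
  obtain \<theta> where \<theta>: "bounded_formula \<theta>"
    "\<And>e c v. P (e 0) \<longleftrightarrow> sat M ((interleave e (case_nat c p))(Suc 0 := v)) s \<theta>"
    using bounded_in_skip[OF p] by blast
  define E where "E = interleave undefined (case_nat (p 0) p)"
  have P: "P n \<longleftrightarrow> sat M (E(0 := n, Suc 0 := v)) s \<theta>" for n v
    using \<theta>(2)[of "undefined(0 := n)" "p 0" v]
    unfolding E_def interleave_fun_upd[of _ _ 0, simplified] by simp
  have "sigma01 (Ex (Suc 0) \<theta>)"
    using \<theta>(1) by (auto simp: sigma01_def)
  moreover have ex: "sat M (E(0 := n)) s (Ex (Suc 0) \<theta>) \<longleftrightarrow> P n" for n
    unfolding sat.simps P[of n, symmetric] by simp
  moreover have "sigma01_induction M" using rca0 by (simp add: RCA0_def)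
  ultimately have "sat M (E(0 := n)) s (Ex (Suc 0) \<theta>)"
    unfolding sigma01_induction_def using s assms(2,3) ex by blast
  then show ?thesis unfolding ex .
qed

section \<open>Arithmetic in a structure satisfying RCA0\<close>


lemma
  shows suc_neq_zero: "n \<oplus> \<one> \<noteq> \<zero>"
    and suc_inject: "m \<oplus> \<one> = n \<oplus> \<one> \<Longrightarrow> m = n"
    and add_zero: "m \<oplus> \<zero> = m"
    and add_suc: "m \<oplus> (n \<oplus> \<one>) = m \<oplus> n \<oplus> \<one>"
    and mult_zero: "m \<otimes> \<zero> = \<zero>"
    and mult_suc: "m \<otimes> (n \<oplus> \<one>) = m \<otimes> n \<oplus> m"
    and not_less_zero: "\<not> m \<prec> \<zero>"
    and less_suc_iff: "m \<prec> n \<oplus> \<one> \<longleftrightarrow> m \<prec> n \<or> m = n"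
  using rca0 unfolding RCA0_def basic_axioms_def by blast+

lemma add_assoc: "a \<oplus> b \<oplus> c = a \<oplus> (b \<oplus> c)"
proof (induction c rule: bounded_induct)
  case definable show ?case by (intro bounded_intros term_intros)
qed (simp_all add: add_zero add_suc)

lemma zero_add: "\<zero> \<oplus> a = a"
proof (induction a rule: bounded_induct)
  case definable show ?case by (intro bounded_intros term_intros)
qed (simp_all add: add_zero add_suc)

lemma suc_add: "a \<oplus> \<one> \<oplus> b = a \<oplus> b \<oplus> \<one>"
proof (induction b rule: bounded_induct)
  case definable show ?case by (intro bounded_intros term_intros)
qed (simp_all add: add_zero add_suc)

lemma add_comm: "a \<oplus> b = b \<oplus> a"
proof (induction b rule: bounded_induct)
  case definable show ?case by (intro bounded_intros term_intros)
qed (simp_all add: add_zero zero_add add_suc suc_add)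

lemma add_left_comm: "a \<oplus> (b \<oplus> c) = b \<oplus> (a \<oplus> c)"
  by (metis add_assoc add_comm)

lemmas add_ac = add_assoc add_comm add_left_comm

lemma add_right_cancel: "a \<oplus> c = b \<oplus> c \<longleftrightarrow> a = b"
proof (induction c rule: bounded_induct)
  case definable show ?case
    \<comment> \<open>Formulas have no biconditional.\<close>
    unfolding iff_conv_conj_imp by (intro bounded_intros term_intros)
qed (auto simp: add_zero add_suc dest: suc_inject)

lemma add_left_cancel: "c \<oplus> a = c \<oplus> b \<longleftrightarrow> a = b"
  using add_right_cancel[of a c b] by (simp add: add_comm)

lemma suc_mult: "(a \<oplus> \<one>) \<otimes> b = a \<otimes> b \<oplus> b"
proof (induction b rule: bounded_induct)
  case definable show ?case by (intro bounded_intros term_intros)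
qed (simp_all add: add_zero mult_zero mult_suc add_ac)

lemma zero_less_suc: "\<zero> \<prec> a \<oplus> \<one>"
proof (induction a rule: bounded_induct)
  case definable show ?case by (intro bounded_intros term_intros)
qed (simp_all add: less_suc_iff)

lemma suc_less_suc: "a \<prec> b \<Longrightarrow> a \<oplus> \<one> \<prec> b \<oplus> \<one>"
proof -
  have "a \<prec> b \<longrightarrow> a \<oplus> \<one> \<prec> b \<oplus> \<one>"
  proof (induction b rule: bounded_induct)
    case definable show ?case by (intro bounded_intros term_intros)
  qed (auto simp: not_less_zero less_suc_iff)
  then show "a \<prec> b \<Longrightarrow> a \<oplus> \<one> \<prec> b \<oplus> \<one>" by blast
qed

lemma less_add_suc: "a \<prec> a \<oplus> (b \<oplus> \<one>)"
proof (induction b rule: bounded_induct)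
  case definable show ?case by (intro bounded_intros term_intros)
qed (simp_all add: add_zero add_suc less_suc_iff)

text \<open>In the induction the witness is bounded by \<open>b\<close>, which keeps the induction
  predicate bounded.\<close>

lemma less_iff_add: "a \<prec> b \<longleftrightarrow> (\<exists>k. b = a \<oplus> (k \<oplus> \<one>))"
proof
  have "a \<prec> b \<longrightarrow> (\<exists>k. k \<prec> b \<and> b = a \<oplus> (k \<oplus> \<one>))"
  proof (induction b rule: bounded_induct)
    case definable show ?case by (intro bounded_intros term_intros)
  next
    case zero show ?case by (simp add: not_less_zero)
  next
    case (suc n)
    show ?case
    proof
      assume "a \<prec> n \<oplus> \<one>"
      then consider "a \<prec> n" | "a = n" by (auto simp: less_suc_iff)
      then show "\<exists>k. k \<prec> n \<oplus> \<one> \<and> n \<oplus> \<one> = a \<oplus> (k \<oplus> \<one>)"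
      proof cases
        case 1
        then obtain k where "k \<prec> n" "n = a \<oplus> (k \<oplus> \<one>)" using suc by blast
        then show ?thesis by (metis suc_less_suc add_suc)
      next
        case 2
        then show ?thesis by (metis add_suc add_zero zero_less_suc)
      qed
    qed
  qed
  then show "a \<prec> b \<Longrightarrow> \<exists>k. b = a \<oplus> (k \<oplus> \<one>)" by blast
qed (auto simp: less_add_suc)

lemma less_trans: "a \<prec> b \<Longrightarrow> b \<prec> c \<Longrightarrow> a \<prec> c"
  unfolding less_iff_add by (metis add_assoc add_suc)

lemma less_irrefl: "\<not> a \<prec> a"
  unfolding less_iff_add by (metis add_left_cancel add_zero suc_neq_zero)

lemma less_linear: "a \<prec> b \<or> a = b \<or> b \<prec> a"
proof (induction b rule: bounded_induct)
  case definable show ?case by (intro bounded_intros term_intros)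
next
  case zero show ?case using zero_less_suc[of a] by (auto simp: less_suc_iff)
next
  case (suc n)
  then show ?case using suc_less_suc[of n a] by (auto simp: less_suc_iff)
qed

lemma le_add: "a \<prec> a \<oplus> b \<oplus> \<one>"
  using less_add_suc by (simp add: add_assoc)

lemma less_add: "a \<prec> b \<Longrightarrow> a \<prec> b \<oplus> c"
  using le_add[of b c] less_trans by (auto simp: less_suc_iff)

lemma add_less_left: "a \<prec> b \<Longrightarrow> c \<oplus> a \<prec> c \<oplus> b"
  unfolding less_iff_add by (metis add_assoc)

section \<open>The pairing function\<close>

lemma less_square:
  assumes "i \<prec> s \<oplus> \<one>"
  shows "s \<otimes> s \<oplus> i \<prec> (s \<oplus> (k \<oplus> \<one>)) \<otimes> (s \<oplus> (k \<oplus> \<one>))"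
proof (induction k rule: bounded_induct)
  case definable show ?case by (intro bounded_intros term_intros)
next
  case zero
  have "s \<otimes> s \<oplus> i \<prec> s \<otimes> s \<oplus> (s \<oplus> \<one>) \<oplus> s"
    by (intro less_add add_less_left assms)
  also have "s \<otimes> s \<oplus> (s \<oplus> \<one>) \<oplus> s = (s \<oplus> (\<zero> \<oplus> \<one>)) \<otimes> (s \<oplus> (\<zero> \<oplus> \<one>))"
    by (simp only: zero_add mult_suc suc_mult) (simp only: add_ac)
  finally show ?case .
next
  case (suc n)
  let ?t = "s \<oplus> (n \<oplus> \<one>)"
  have "s \<otimes> s \<oplus> i \<prec> ?t \<otimes> ?t \<oplus> (?t \<oplus> (?t \<oplus> \<one>))"
    by (intro less_add suc)
  also have "t \<otimes> t \<oplus> (t \<oplus> (t \<oplus> \<one>)) = (t \<oplus> \<one>) \<otimes> (t \<oplus> \<one>)" for t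
    by (simp only: mult_suc suc_mult) (simp only: add_ac)
  finally show ?case by (simp only: add_assoc)
qed

text \<open>A code with sum s is s^2 + i with i \<le> s, hence below (s + 1)^2 and below every code
  with a larger sum. So a code determines its sum, and then its components.\<close>

lemma pair_code_less:
  assumes "i \<oplus> j \<prec> i' \<oplus> j'"
  shows "pair_code M i j \<prec> pair_code M i' j'"
proof -
  obtain k where k: "i' \<oplus> j' = i \<oplus> j \<oplus> (k \<oplus> \<one>)"
    using assms less_iff_add by blast
  show ?thesis unfolding pair_code_def k by (intro less_add less_square le_add)
qed

lemma pair_code_inject: "pair_code M i j = pair_code M i' j' \<longleftrightarrow> i = i' \<and> j = j'"
proof
  assume eq: "pair_code M i j = pair_code M i' j'"
  then have "i \<oplus> j = i' \<oplus> j'"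
    using less_linear[of "i \<oplus> j" "i' \<oplus> j'"] pair_code_less less_irrefl by metis
  with eq show "i = i' \<and> j = j'"
    unfolding pair_code_def by (metis add_left_cancel)
qed simp

text \<open>No component exceeds the code, so quantifiers over components can be bounded by the
  code.\<close>

lemma fst_le_pair_code: "i \<prec> pair_code M i j \<oplus> \<one>"
  unfolding pair_code_def using le_add by (metis add_comm)

lemma zero_or_suc: "a = \<zero> \<or> (\<exists>b. a = b \<oplus> \<one>)"
  using zero_less_suc[of a] less_iff_add[of \<zero> a] by (auto simp: less_suc_iff zero_add)

text \<open>If i + j = b + 1, then (i + j)^2 = (i + j) * b + i + j, which has j as a
  summand.\<close>

lemma snd_le_pair_code: "j \<prec> pair_code M i j \<oplus> \<one>"
proof (cases "i \<oplus> j = \<zero>")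
  case True
  then have "j = \<zero>" using zero_or_suc[of j] by (auto simp: add_suc suc_neq_zero)
  then show ?thesis by (simp add: zero_less_suc)
next
  case False
  then obtain b where "i \<oplus> j = b \<oplus> \<one>" using zero_or_suc by blast
  then have "pair_code M i j = j \<oplus> ((i \<oplus> j) \<otimes> b \<oplus> i \<oplus> i)"
    unfolding pair_code_def by (metis mult_suc add_ac)
  then show ?thesis using le_add by metis
qed

end

section \<open>Arithmetical comprehension from projections\<close>

definition projection_closed :: "'n L2_structure \<Rightarrow> bool" where
  "projection_closed M \<longleftrightarrow>
     (\<forall>T\<in>Sets M. \<exists>Z\<in>Sets M. \<forall>n. n \<in> Z \<longleftrightarrow> (\<exists>m. pair_code M n m \<in> T))"

lemma ACA0_imp_projection_closed:
  assumes "ACA0 M"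
  shows "projection_closed M"
  unfolding projection_closed_def
proof
  fix T assume "T \<in> Sets M"
  define \<tau> where "\<tau> = PlusT (TimesT (PlusT (Var 0) (Var 1)) (PlusT (Var 0) (Var 1))) (Var 0)"
  have "arithmetical (Ex 1 (Mem \<tau> 0))" "range (\<lambda>_::nat. T) \<subseteq> Sets M"
    using \<open>T \<in> Sets M\<close> by auto
  then have "\<exists>Z\<in>Sets M. \<forall>n. n \<in> Z \<longleftrightarrow> sat M (undefined(0 := n)) (\<lambda>_. T) (Ex 1 (Mem \<tau> 0))"
    using assms unfolding ACA0_def arithmetical_comprehension_def by blast
  then show "\<exists>Z\<in>Sets M. \<forall>n. n \<in> Z \<longleftrightarrow> (\<exists>m. pair_code M n m \<in> T)"
    by (simp add: \<tau>_def pair_code_def)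
qed

context rca0 begin

text \<open>The quantifiers over the components are bounded by the code \<open>z\<close>. That
  \<open>Z\<close> consists of codes of pairs only is what \<open>is_function\<close> asks of the
  graph of a function.\<close>

lemma bounded_relation:
  assumes "bounded_def M (\<lambda>e. R (e (Suc 0)) (e 0))"
  obtains Z where "Z \<in> Sets M" "\<And>z. z \<in> Z \<longleftrightarrow> (\<exists>i j. z = pair_code M i j \<and> R i j)"
    "\<And>i j. pair_code M i j \<in> Z \<longleftrightarrow> R i j"
proof -
  let ?P = "\<lambda>z. \<exists>i. i \<prec> z \<oplus> \<one> \<and> (\<exists>j. j \<prec> z \<oplus> \<one> \<and> z = pair_code M i j \<and> R i j)"
  have "bounded_def M (\<lambda>e. ?P (e 0))"
    by (intro bounded_intros term_intros assms)
  then obtain Z where "Z \<in> Sets M" and Z: "\<And>z. z \<in> Z \<longleftrightarrow> ?P z"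
    by (rule bounded_comprehension1[of ?P]) (rule that)
  have z: "z \<in> Z \<longleftrightarrow> (\<exists>i j. z = pair_code M i j \<and> R i j)" for z
    unfolding Z using fst_le_pair_code snd_le_pair_code by blast
  show ?thesis by (rule that[OF \<open>Z \<in> Sets M\<close> z]) (auto simp: z pair_code_inject)
qed

text \<open>For codes of double sequences, which pair twice. The positions of the arguments are
  arbitrary because the two bounded quantifiers shift them.\<close>

lemma bounded_relation3:
  assumes "\<And>a b c. bounded_def M (\<lambda>e. R (e a) (e b) (e c))"
  obtains Z where "Z \<in> Sets M" "\<And>i j k. pair_code M (pair_code M i j) k \<in> Z \<longleftrightarrow> R i j k"
proof -
  let ?R = "\<lambda>p k. \<exists>i. i \<prec> p \<oplus> \<one> \<and> (\<exists>j. j \<prec> p \<oplus> \<one> \<and> p = pair_code M i j \<and> R i j k)"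
  have "bounded_def M (\<lambda>e. ?R (e (Suc 0)) (e 0))"
    by (intro bounded_intros term_intros assms)
  then obtain Z where "Z \<in> Sets M" "\<And>p k. pair_code M p k \<in> Z \<longleftrightarrow> ?R p k"
    by (rule bounded_relation[of ?R]) (rule that)
  moreover have "?R (pair_code M i j) k \<longleftrightarrow> R i j k" for i j k
    by (auto simp: pair_code_inject fst_le_pair_code snd_le_pair_code)
  ultimately show ?thesis using that by simp
qed

text \<open>Without a least element, induction on k shows that \<open>P\<close> fails everywhere
  below k.\<close>

lemma bounded_least:
  assumes "bounded_def M (\<lambda>e. P (e 0))" "P n"
  obtains n where "P n" "\<And>m. m \<prec> n \<Longrightarrow> \<not> P m"
proof (rule ccontr)
  assume "\<not> thesis"
  with that have no_least: "\<And>n. P n \<Longrightarrow> \<exists>m. m \<prec> n \<and> P m" by blast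
  have P: "bounded_def M (\<lambda>e. P (e i))" for i
    using bounded_def_reindex[OF assms(1), of "\<lambda>j. j + i"] by simp
  have "\<forall>m. m \<prec> k \<longrightarrow> \<not> P m" for k
  proof (induction k rule: bounded_induct)
    case definable show ?case by (intro bounded_intros term_intros P)
  qed (use no_least in \<open>auto simp: not_less_zero less_suc_iff\<close>)
  then show False using assms(2) less_suc_iff by blast
qed

text \<open>Coding two variables by their pair lowers the number of free variables until a single one is
  left besides the quantified one; then the projection of a set gives the quantifier.\<close>

lemma projection_exists_aux:
  assumes proj: "projection_closed M"
    and "bounded_def M P" "\<And>e e'. (\<forall>i<Suc (Suc N). e i = e' i) \<Longrightarrow> P e = P e'"
  shows "bounded_def M (\<lambda>e. \<exists>v. P (case_nat v e))"
  using assms(2,3)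
proof (induction N arbitrary: P)
  case 0
  \<comment> \<open>Only the quantified variable and one other matter, so a constant assignment can
    supply the latter.\<close>
  let ?R = "\<lambda>n v. P (case_nat v (\<lambda>_. n))"
  have "(\<lambda>e. ?R (e (Suc 0)) (e 0)) = P"
    by (intro ext 0(2)) (auto simp: less_Suc_eq)
  with 0(1) have "bounded_def M (\<lambda>e. ?R (e (Suc 0)) (e 0))" by simp
  then obtain T where "T \<in> Sets M" and T: "\<And>n v. pair_code M n v \<in> T \<longleftrightarrow> ?R n v"
    by (rule bounded_relation[of ?R]) (rule that)
  then obtain Z where "Z \<in> Sets M" and Z: "\<And>n. n \<in> Z \<longleftrightarrow> (\<exists>v. P (case_nat v (\<lambda>_. n)))"
    using proj unfolding projection_closed_def by metis
  have "P (case_nat v (\<lambda>_. e 0)) = P (case_nat v e)" for v e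
    by (rule 0(2)) (auto simp: less_Suc_eq)
  then have "(\<lambda>e. \<exists>v. P (case_nat v e)) = (\<lambda>e. e 0 \<in> Z)" by (simp add: Z)
  then show ?case using bounded_def_mem[OF \<open>Z \<in> Sets M\<close> term_def_var] by simp
next
  case (Suc N)
  \<comment> \<open>Argument 1 of \<open>P'\<close> codes arguments 1 and 2 of \<open>P\<close>; the
    later ones move down by one.\<close>
  define P' where "P' e \<longleftrightarrow> (\<exists>a. a \<prec> e (Suc 0) \<oplus> \<one> \<and> (\<exists>b. b \<prec> e (Suc 0) \<oplus> \<one> \<and>
    e (Suc 0) = pair_code M a b \<and>
    P (case_nat (e 0) (case_nat a (case_nat b (\<lambda>i. e (Suc (Suc i))))))))" for e
  \<comment> \<open>Below the two bounded quantifiers, position 0 holds b, 1 holds a, 2 holds the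
    old argument 0, and 3 holds the code, which \<open>P\<close> does not receive.\<close>
  let ?h = "case_nat (Suc (Suc 0)) (case_nat (Suc 0) (case_nat 0 (\<lambda>i. Suc (Suc (Suc (Suc i))))))"
  have "inj ?h" by (intro inj_case_nat) (auto simp: inj_def image_iff split: nat.splits)
  moreover have "(\<lambda>i. e (?h i)) = case_nat (e (Suc (Suc 0))) (case_nat (e (Suc 0))
      (case_nat (e 0) (\<lambda>i. e (Suc (Suc (Suc (Suc i)))))))" for e :: "nat \<Rightarrow> 'n"
    by (auto simp: fun_eq_iff split: nat.split)
  ultimately have "bounded_def M (\<lambda>e. P (case_nat (e (Suc (Suc 0))) (case_nat (e (Suc 0))
      (case_nat (e 0) (\<lambda>i. e (Suc (Suc (Suc (Suc i)))))))))"
    using bounded_def_reindex[OF Suc.prems(1), of ?h] by simp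
  then have "bounded_def M P'"
    unfolding P'_def by (intro bounded_intros term_intros)
  moreover have "P' e = P' e'" if "\<forall>i<Suc (Suc N). e i = e' i" for e e'
  proof -
    have "P (case_nat (e 0) (case_nat a (case_nat b (\<lambda>i. e (Suc (Suc i)))))) =
        P (case_nat (e' 0) (case_nat a (case_nat b (\<lambda>i. e' (Suc (Suc i))))))" for a b
      using that by (intro Suc.prems(2)) (auto split: nat.splits)
    then show ?thesis using that by (simp add: P'_def)
  qed
  ultimately have Q: "bounded_def M (\<lambda>e. \<exists>v. P' (case_nat v e))"
    by (rule Suc.IH)
  \<comment> \<open>Below the quantifier over \<open>u\<close>, positions 1 and 2 hold the two
    components; they are skipped because \<open>u\<close> replaces them.\<close>
  let ?k = "case_nat 0 (\<lambda>i. Suc (Suc (Suc i)))"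
  have "inj ?k" by (intro inj_case_nat) (auto simp: inj_def)
  from bounded_def_reindex[OF Q this]
  have Q': "bounded_def M (\<lambda>e. \<exists>v. P' (case_nat v (\<lambda>i. e (?k i))))" .
  \<comment> \<open>Reindexing substitutes variables only, so a bounded quantifier names the code
    \<open>u\<close> instead of a substitution of the pairing term.\<close>
  let ?Q = "\<lambda>e. \<exists>u. u \<prec> pair_code M (e 0) (e (Suc 0)) \<oplus> \<one> \<and> u = pair_code M (e 0) (e (Suc 0)) \<and>
    (\<exists>v. P' (case_nat v (case_nat u (\<lambda>i. e (Suc (Suc i))))))"
  have k: "(\<lambda>i. e (?k i)) = case_nat (e 0) (\<lambda>i. e (Suc (Suc (Suc i))))" for e :: "nat \<Rightarrow> 'n"
    by (auto split: nat.splits simp: fun_eq_iff)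
  have "bounded_def M ?Q"
    by (intro bounded_def_bex bounded_def_conj bounded_def_eq term_intros) (rule Q'[unfolded k])
  moreover have "?Q = (\<lambda>e. \<exists>v. P (case_nat v e))"
  proof
    fix e :: "nat \<Rightarrow> 'n"
    have "P (case_nat v (case_nat (e 0) (case_nat (e (Suc 0)) (\<lambda>i. e (Suc (Suc i)))))) = P (case_nat v e)" for v
      by (rule Suc.prems(2)) (auto split: nat.splits)
    then show "?Q e \<longleftrightarrow> (\<exists>v. P (case_nat v e))"
      using fst_le_pair_code[of "e 0" "e (Suc 0)"] snd_le_pair_code[of "e (Suc 0)" "e 0"]
      by (simp add: P'_def pair_code_inject less_suc_iff)
  qed
  ultimately show ?case by simp
qed

lemma bounded_def_ex:
  assumes "projection_closed M" "bounded_def M (\<lambda>e. P (e 0) (\<lambda>i. e (Suc i)))"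
  shows "bounded_def M (\<lambda>e. \<exists>v. P v e)"
proof -
  let ?P = "\<lambda>e. P (e 0) (\<lambda>i. e (Suc i))"
  obtain N where N: "\<And>e e'. (\<forall>i<N. e i = e' i) \<Longrightarrow> ?P e = ?P e'"
    using bounded_def_finite_support[OF assms(2)] unfolding finite_support_def by blast
  have "?P e = ?P e'" if "\<forall>i<Suc (Suc N). e i = e' i" for e e'
    using that by (intro N) auto
  from projection_exists_aux[OF assms this] show ?thesis by simp
qed

lemma bounded_def_all:
  assumes "projection_closed M" "bounded_def M (\<lambda>e. P (e 0) (\<lambda>i. e (Suc i)))"
  shows "bounded_def M (\<lambda>e. \<forall>v. P v e)"
  using bounded_def_not[OF bounded_def_ex[OF assms(1), of "\<lambda>v e. \<not> P v e"]]
    bounded_def_not[OF assms(2)] by simp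

text \<open>Each number quantifier is absorbed into a set parameter, by induction on the formula;
  set quantifiers do not occur in arithmetical formulas.\<close>

lemma bounded_def_sat:
  assumes "projection_closed M" "arithmetical \<phi>" "range s \<subseteq> Sets M"
  shows "bounded_def M (\<lambda>e. sat M e s \<phi>)"
proof -
  have terms: "term_def M (\<lambda>e. term_val M e t)" for t
    by (induction t) (auto intro: term_intros)
  have ex: "bounded_def M (\<lambda>e. \<exists>n. P (e(x := n)))" if "bounded_def M P" for P x
  proof -
    \<comment> \<open>The named variable x is sent to argument 0, where
      \<open>bounded_def_ex\<close> expects the bound variable.\<close>
    let ?h = "\<lambda>i. if i = x then 0 else Suc i"
    have "inj ?h" by (rule injI) (auto split: if_splits)
    from bounded_def_reindex[OF that this]
    have "bounded_def M (\<lambda>e. P ((\<lambda>i. e (Suc i))(x := e 0)))"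
      by (simp add: fun_upd_def if_distrib cong: if_cong)
    then show ?thesis by (rule bounded_def_ex[OF assms(1)])
  qed
  show ?thesis
    using assms(2)
  proof (induction \<phi>)
    case (All x \<phi>)
    then have "bounded_def M (\<lambda>e. \<not> sat M e s \<phi>)" by (intro bounded_def_not) simp
    from bounded_def_not[OF ex[OF this]] show ?case by simp
  next
    case (Ex x \<phi>)
    then show ?case using ex by simp
  qed (use assms(3) in \<open>auto intro!: bounded_intros terms\<close>)
qed

lemma projection_closed_imp_ACA0:
  assumes "projection_closed M"
  shows "ACA0 M"
proof -
  have "arithmetical_comprehension M"
    unfolding arithmetical_comprehension_def
    by (intro allI impI bounded_comprehension bounded_def_sat assms)
  moreover have "induction_axiom M"
    unfolding induction_axiom_def
  proof (intro ballI impI allI)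
    fix Z n assume *: "Z \<in> Sets M" "\<zero> \<in> Z" "\<forall>n. n \<in> Z \<longrightarrow> n \<oplus> \<one> \<in> Z"
    have "bounded_def M (\<lambda>e. e 0 \<in> Z)" by (intro bounded_def_mem term_intros *(1))
    then show "n \<in> Z" by (rule bounded_induct) (use * in blast)+
  qed
  ultimately show ?thesis using rca0 by (simp add: ACA0_def RCA0_def)
qed

section \<open>V-spaces under arithmetical comprehension\<close>


lemma fun_app_eqI:
  assumes "is_function M f X Y" "x \<in> X"
  shows "pair_code M x y \<in> f \<longleftrightarrow> y = fun_app M f x"
proof -
  have "\<exists>!y. pair_code M x y \<in> f" using assms by (simp add: is_function_def)
  from theI'[OF this] this show ?thesis unfolding fun_app_def by blast
qed

lemma pair_code_in_function:
  assumes "is_function M f X Y" "pair_code M x y \<in> f"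
  shows "x \<in> X" "y \<in> Y"
proof -
  obtain x' y' where "x' \<in> X" "y' \<in> Y" "pair_code M x y = pair_code M x' y'"
    using assms unfolding is_function_def by blast
  then show "x \<in> X" "y \<in> Y" by (simp_all add: pair_code_inject)
qed

text \<open>Covers both kinds of V-space: a weak one is the case \<open>J = UNIV\<close>.\<close>

lemma connected_locally_constant:
  assumes proj: "projection_closed M"
    and sets: "J \<in> Sets M" "S \<in> Sets M"
    and vic: "\<And>x n. x \<in> X \<Longrightarrow> n \<in> seq_term M J x \<Longrightarrow>
      x \<in> seq_term M (seq_term M S x) n \<and> seq_term M (seq_term M S x) n \<subseteq> X"
    and fn: "is_function M \<pi> X Y" and ab: "a \<in> X" "b \<in> X"
    and conn: "V_connected M X (strong_vicinities M J S) a b"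
    and const: "\<And>x. x \<in> X \<Longrightarrow> \<exists>U\<in>strong_vicinities M J S x. is_constant_on M \<pi> U"
  shows "fun_app M \<pi> a = fun_app M \<pi> b"
proof -
  \<comment> \<open>On X this says that n indexes a vicinity of x on which \<open>\<pi>\<close> is
    constant. It is phrased with codes because \<open>fun_app\<close> is not a term of the
    language.\<close>
  define C where "C x n \<longleftrightarrow> pair_code M n x \<in> J \<and>
    (\<forall>u v y. pair_code M (pair_code M u n) x \<in> S \<longrightarrow> pair_code M (pair_code M v n) x \<in> S \<longrightarrow>
      pair_code M u y \<in> \<pi> \<longrightarrow> pair_code M v y \<in> \<pi>)" for x n
  have \<pi>: "\<pi> \<in> Sets M" using fn by (simp add: is_function_def)
  have C: "C x n \<longleftrightarrow> n \<in> seq_term M J x \<and> is_constant_on M \<pi> (seq_term M (seq_term M S x) n)"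
    if "x \<in> X" for x n
  proof (cases "pair_code M n x \<in> J")
    case True
    have "pair_code M u y \<in> \<pi> \<longleftrightarrow> y = fun_app M \<pi> u"
      if "pair_code M (pair_code M u n) x \<in> S" for u y
    proof -
      have "u \<in> X" using vic[OF \<open>x \<in> X\<close>] True that by (auto simp: seq_term_def)
      then show ?thesis by (rule fun_app_eqI[OF fn])
    qed
    then have "C x n \<longleftrightarrow> (\<forall>u v. pair_code M (pair_code M u n) x \<in> S \<longrightarrow>
        pair_code M (pair_code M v n) x \<in> S \<longrightarrow> fun_app M \<pi> u = fun_app M \<pi> v)"
      unfolding C_def using True by simp
    then show ?thesis
      using True unfolding is_constant_on_def seq_term_def mem_Collect_eq by blast
  qed (simp add: C_def seq_term_def)
  have bC: "bounded_def M (\<lambda>e. C (e i) (e j))" for i j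
    unfolding C_def
    by (intro bounded_intros term_intros bounded_def_all[OF proj] sets \<pi>)
  let ?V = "\<lambda>i x. \<exists>n. C x n \<and> (\<forall>m. m \<prec> n \<longrightarrow> \<not> C x m) \<and> pair_code M (pair_code M i n) x \<in> S"
  have "bounded_def M (\<lambda>e. ?V (e (Suc 0)) (e 0))"
    by (intro bounded_intros term_intros bounded_def_ex[OF proj] bC sets)
  then obtain V where V: "V \<in> Sets M" "\<And>i x. pair_code M i x \<in> V \<longleftrightarrow> ?V i x"
    by (rule bounded_relation[of ?V]) (rule that)
  have cover: "\<exists>n. C x n \<and> seq_term M V x = seq_term M (seq_term M S x) n" if x: "x \<in> X" for x
  proof -
    obtain n where "C x n"
      using const[OF x] C[OF x] by (auto simp: strong_vicinities_def)
    have "bounded_def M (\<lambda>e. C x (e 0))"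
      unfolding C_def by (intro bounded_intros term_intros bounded_def_all[OF proj] sets \<pi>)
    then obtain n where n: "C x n" "\<And>m. m \<prec> n \<Longrightarrow> \<not> C x m"
      using bounded_least[of "C x", OF _ \<open>C x n\<close>] by blast
    have unique: "m = n" if "C x m" "\<forall>k. k \<prec> m \<longrightarrow> \<not> C x k" for m
      using that n less_linear[of m n] by blast
    have "?V i x \<longleftrightarrow> pair_code M (pair_code M i n) x \<in> S" for i
      using n unique by blast
    then have "seq_term M V x = seq_term M (seq_term M S x) n"
      by (simp add: seq_term_def V(2))
    with n show ?thesis by blast
  qed
  have "V_cover M X (strong_vicinities M J S) V"
    unfolding V_cover_def using V(1) cover C by (fastforce simp: strong_vicinities_def)
  then obtain k \<sigma> where \<sigma>: "finite_seq M \<sigma> (k \<oplus> \<one>) X"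
    and ends: "a = fun_app M \<sigma> \<zero>" "b = fun_app M \<sigma> k"
    and meet: "\<And>j. j \<prec> k \<Longrightarrow> seq_term M V (fun_app M \<sigma> j) \<inter> seq_term M V (fun_app M \<sigma> (j \<oplus> \<one>)) \<noteq> {}"
    using conn unfolding V_connected_def by blast
  have fs: "is_function M \<sigma> {i. i \<prec> k \<oplus> \<one>} X" using \<sigma> by (simp add: finite_seq_def)
  then have \<sigma>_set: "\<sigma> \<in> Sets M" by (simp add: is_function_def)
  have \<sigma>_app: "pair_code M j y \<in> \<sigma> \<longleftrightarrow> y = fun_app M \<sigma> j" if "j \<prec> k \<oplus> \<one>" for j y
    using fun_app_eqI[OF fs] that by simp
  have \<sigma>_X: "fun_app M \<sigma> j \<in> X" if "j \<prec> k \<oplus> \<one>" for j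
    using \<sigma>_app[OF that] pair_code_in_function(2)[OF fs] by blast
  have step: "fun_app M \<pi> u = fun_app M \<pi> w" if u: "u \<in> X" and w: "w \<in> seq_term M V u" for u w
  proof -
    obtain n where "C u n" "seq_term M V u = seq_term M (seq_term M S u) n"
      using cover[OF u] by blast
    then have "u \<in> seq_term M V u" "is_constant_on M \<pi> (seq_term M V u)"
      using C[OF u] vic[OF u] by simp_all
    then show ?thesis using w unfolding is_constant_on_def by blast
  qed
  \<comment> \<open>The chain may have nonstandard length, so constancy along it needs induction
    inside the structure, and hence a definable form that avoids \<open>fun_app\<close>.\<close>
  define Q where "Q j \<longleftrightarrow> (j \<prec> k \<oplus> \<one> \<longrightarrow>
    (\<forall>y. pair_code M j y \<in> \<sigma> \<longrightarrow> pair_code M y (fun_app M \<pi> a) \<in> \<pi>))" for j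
  have Q: "Q j \<longleftrightarrow> (j \<prec> k \<oplus> \<one> \<longrightarrow> fun_app M \<pi> (fun_app M \<sigma> j) = fun_app M \<pi> a)" for j
    unfolding Q_def using \<sigma>_app[of j] fun_app_eqI[OF fn \<sigma>_X[of j]] by auto
  have "Q k"
  proof (induction k rule: bounded_induct)
    case definable
    show ?case unfolding Q_def
      by (intro bounded_intros term_intros bounded_def_all[OF proj] \<sigma>_set \<pi>)
  next
    case zero show ?case unfolding Q ends by simp
  next
    case (suc j)
    show ?case unfolding Q
    proof
      assume le: "j \<oplus> \<one> \<prec> k \<oplus> \<one>"
      have "j \<prec> j \<oplus> \<one>" by (simp add: less_suc_iff)
      then have "j \<prec> k"
        using le less_trans[of j "j \<oplus> \<one>" k] unfolding less_suc_iff[of _ k] by blast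
      then have j: "j \<prec> k" "j \<prec> k \<oplus> \<one>" by (simp_all add: less_suc_iff)
      obtain w where "w \<in> seq_term M V (fun_app M \<sigma> j)" "w \<in> seq_term M V (fun_app M \<sigma> (j \<oplus> \<one>))"
        using meet[OF j(1)] by blast
      then show "fun_app M \<pi> (fun_app M \<sigma> (j \<oplus> \<one>)) = fun_app M \<pi> a"
        using step \<sigma>_X[OF j(2)] \<sigma>_X[OF le] suc j(2) unfolding Q by metis
    qed
  qed
  then show ?thesis unfolding Q ends by (simp add: less_suc_iff)
qed

section \<open>The space of a projection\<close>


lemma less_one_iff: "i \<prec> \<one> \<longleftrightarrow> i = \<zero>"
  using less_suc_iff[of i \<zero>] by (simp add: zero_add not_less_zero)

lemma one_neq_zero: "\<one> \<noteq> \<zero>"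
  using suc_neq_zero[of \<zero>] by (simp add: zero_add)

lemma two_neq_one: "\<one> \<oplus> \<one> \<noteq> \<one>"
  using suc_inject[of \<one> \<zero>] one_neq_zero by (auto simp: zero_add)

lemmas tags_distinct = suc_neq_zero suc_neq_zero[symmetric] one_neq_zero one_neq_zero[symmetric]
  two_neq_one two_neq_one[symmetric]

text \<open>The reversal needs no longer chains: a wrong guess at \<open>x\<^sub>n\<close> links
  \<open>z\<^sub>0\<close> to \<open>y\<^sub>0\<close> through \<open>x\<^sub>n\<close>.\<close>

lemma chain_of_three:
  assumes X: "a \<in> X" "x \<in> X" "b \<in> X"
    and meet: "seq_term M V a \<inter> seq_term M V x \<noteq> {}" "seq_term M V x \<inter> seq_term M V b \<noteq> {}"
  shows "\<exists>k \<sigma>. finite_seq M \<sigma> (k \<oplus> \<one>) X \<and> a = fun_app M \<sigma> \<zero> \<and> b = fun_app M \<sigma> k \<and>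
    (\<forall>j. j \<prec> k \<longrightarrow> seq_term M V (fun_app M \<sigma> j) \<inter> seq_term M V (fun_app M \<sigma> (j \<oplus> \<one>)) \<noteq> {})"
proof -
  let ?two = "\<one> \<oplus> \<one>"
  let ?z0 = "pair_code M \<zero> a" and ?z1 = "pair_code M \<one> x" and ?z2 = "pair_code M ?two b"
  have "bounded_def M (\<lambda>e. e 0 = ?z0 \<or> e 0 = ?z1 \<or> e 0 = ?z2)"
    by (intro bounded_intros term_intros)
  then obtain \<sigma> where \<sigma>: "\<sigma> \<in> Sets M" "\<And>z. z \<in> \<sigma> \<longleftrightarrow> z = ?z0 \<or> z = ?z1 \<or> z = ?z2"
    by (rule bounded_comprehension1) (rule that)
  have less3: "i \<prec> ?two \<oplus> \<one> \<longleftrightarrow> i = \<zero> \<or> i = \<one> \<or> i = ?two" for i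
    by (auto simp: less_suc_iff less_one_iff)
  have pairs: "pair_code M i y \<in> \<sigma> \<longleftrightarrow> i = \<zero> \<and> y = a \<or> i = \<one> \<and> y = x \<or> i = ?two \<and> y = b" for i y
    by (auto simp: \<sigma>(2) pair_code_inject)
  have "is_function M \<sigma> {i. i \<prec> ?two \<oplus> \<one>} X"
    unfolding is_function_def
  proof (intro conjI ballI)
    fix z assume "z \<in> \<sigma>"
    then show "\<exists>i\<in>{i. i \<prec> ?two \<oplus> \<one>}. \<exists>y\<in>X. z = pair_code M i y"
      using X by (auto simp: \<sigma>(2) less3)
  next
    fix i assume "i \<in> {i. i \<prec> ?two \<oplus> \<one>}"
    then show "\<exists>!y. pair_code M i y \<in> \<sigma>"
      by (auto simp: less3 pairs tags_distinct)
  qed (rule \<sigma>(1))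
  moreover have "\<exists>b. \<forall>z\<in>\<sigma>. z \<prec> b"
  proof (intro exI ballI)
    fix z assume "z \<in> \<sigma>"
    have "?z0 \<prec> ?z0 \<oplus> (?z1 \<oplus> ?z2) \<oplus> \<one>" "?z1 \<prec> ?z1 \<oplus> (?z0 \<oplus> ?z2) \<oplus> \<one>"
      "?z2 \<prec> ?z2 \<oplus> (?z0 \<oplus> ?z1) \<oplus> \<one>"
      by (rule le_add)+
    then show "z \<prec> ?z0 \<oplus> (?z1 \<oplus> ?z2) \<oplus> \<one>"
      using \<open>z \<in> \<sigma>\<close> by (auto simp: \<sigma>(2) add_ac)
  qed
  moreover have app: "fun_app M \<sigma> \<zero> = a" "fun_app M \<sigma> \<one> = x" "fun_app M \<sigma> ?two = b"
    unfolding fun_app_def by (simp_all add: pairs tags_distinct)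
  moreover have "seq_term M V (fun_app M \<sigma> j) \<inter> seq_term M V (fun_app M \<sigma> (j \<oplus> \<one>)) \<noteq> {}"
    if "j \<prec> ?two" for j
    using that meet by (auto simp: less_suc_iff less_one_iff zero_add app)
  ultimately show ?thesis unfolding finite_seq_def by blast
qed

text \<open>The quantifier is implicitly bounded by the code \<open>e k\<close>. Tests for the kind
  of a point are thus available in RCA0, before any projection is known to exist.\<close>

lemma bounded_def_ex_fst:
  assumes "bounded_def M (\<lambda>e. P (e 0) (\<lambda>i. e (Suc i)))"
  shows "bounded_def M (\<lambda>e. \<exists>n. e k = pair_code M n c \<and> P n e)"
proof -
  have "bounded_def M (\<lambda>e. \<exists>n. n \<prec> e k \<oplus> \<one> \<and> e k = pair_code M n c \<and> P n e)"
    by (intro bounded_intros term_intros assms)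
  moreover have "(\<exists>n. n \<prec> p \<oplus> \<one> \<and> p = pair_code M n c \<and> P n e) \<longleftrightarrow>
      (\<exists>n. p = pair_code M n c \<and> P n e)" for p e
    using fst_le_pair_code by blast
  ultimately show ?thesis by simp
qed

text \<open>The points are \<open>x\<^sub>n = (n,0)\<close> and \<open>z\<^sub>n = (n,1)\<close>, where \<open>\<pi>\<close> is 0, and \<open>y\<^sub>n = (n,2)\<close>, where \<open>\<pi>\<close>
  is 1. The only vicinity of \<open>z\<^sub>n\<close>, and of \<open>y\<^sub>n\<close>, is its fibre of \<open>\<pi>\<close>. Vicinity 0 of \<open>x\<^sub>n\<close> is a
  guess that \<open>n\<close> is not in the projection of \<open>T\<close>, and vicinity \<open>m + 1\<close> a guess that \<open>(n,m) \<in> T\<close>;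
  a wrong guess contains some \<open>y\<^sub>i\<close>, which links the two fibres. The members \<open>z\<^sub>k\<close> make the vicinities
  of \<open>x\<^sub>n\<close> distinct and let the guess be read off a vicinity. The conjuncts \<open>True\<close> fit the
  definition to \<open>bounded_def_ex_fst\<close>.\<close>

definition in_vicinity :: "'n set \<Rightarrow> 'n \<Rightarrow> 'n \<Rightarrow> 'n \<Rightarrow> bool" where
  "in_vicinity T i k x \<longleftrightarrow>
     (\<exists>n. x = pair_code M n \<zero> \<and>
        (i = x \<or> i = pair_code M k \<one> \<or>
         k = \<zero> \<and> (\<exists>m. i = pair_code M m (\<one> \<oplus> \<one>) \<and> pair_code M n m \<in> T) \<or>
         i = pair_code M \<zero> (\<one> \<oplus> \<one>) \<and> (\<exists>m. m \<prec> k \<and> k = m \<oplus> \<one> \<and> pair_code M n m \<notin> T))) \<or>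
     (\<exists>n. x = pair_code M n \<one> \<and> True) \<and>
        ((\<exists>m. i = pair_code M m \<zero> \<and> True) \<or> (\<exists>m. i = pair_code M m \<one> \<and> True)) \<or>
     (\<exists>n. x = pair_code M n (\<one> \<oplus> \<one>) \<and> True) \<and> (\<exists>m. i = pair_code M m (\<one> \<oplus> \<one>) \<and> True)"

lemma in_vicinity_simps:
  "in_vicinity T i \<zero> (pair_code M n \<zero>) \<longleftrightarrow> i = pair_code M n \<zero> \<or> i = pair_code M \<zero> \<one> \<or>
     (\<exists>m. i = pair_code M m (\<one> \<oplus> \<one>) \<and> pair_code M n m \<in> T)"
  "in_vicinity T i (m \<oplus> \<one>) (pair_code M n \<zero>) \<longleftrightarrow> i = pair_code M n \<zero> \<or> i = pair_code M (m \<oplus> \<one>) \<one> \<or>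
     i = pair_code M \<zero> (\<one> \<oplus> \<one>) \<and> pair_code M n m \<notin> T"
  "in_vicinity T i k (pair_code M n \<one>) \<longleftrightarrow> (\<exists>m. i = pair_code M m \<zero> \<or> i = pair_code M m \<one>)"
  "in_vicinity T i k (pair_code M n (\<one> \<oplus> \<one>)) \<longleftrightarrow> (\<exists>m. i = pair_code M m (\<one> \<oplus> \<one>))"
  unfolding in_vicinity_def
  by (auto simp: pair_code_inject tags_distinct not_less_zero less_suc_iff dest: suc_inject)

text \<open>The constant vicinities refute the conclusion of (2) and of (3), so either statement
  makes connectedness fail, and the last conclusion then applies. One \<open>S\<close> codes both
  kinds of space: at the points z and y all its terms agree, as a weak system permits, and
  \<open>J\<close> keeps a single index there.\<close>

lemma projection_space:
  assumes T: "T \<in> Sets M"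
  obtains X J S \<pi> a b where
    "strong_V_space M X J S" "weak_V_space M X S"
    "\<And>x. x \<in> X \<Longrightarrow> weak_vicinities M S x = strong_vicinities M J S x"
    "is_function M \<pi> X UNIV" "a \<in> X" "b \<in> X" "fun_app M \<pi> a \<noteq> fun_app M \<pi> b"
    "\<And>x. x \<in> X \<Longrightarrow> \<exists>U\<in>strong_vicinities M J S x. is_constant_on M \<pi> U"
    "\<not> V_connected M X (strong_vicinities M J S) a b \<Longrightarrow>
      \<exists>Z\<in>Sets M. \<forall>n. n \<in> Z \<longleftrightarrow> (\<exists>m. pair_code M n m \<in> T)"
proof -
  let ?two = "\<one> \<oplus> \<one>"
  let ?x = "\<lambda>n. pair_code M n \<zero>" and ?z = "\<lambda>n. pair_code M n \<one>" and ?y = "\<lambda>n. pair_code M n ?two"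
  let ?isx = "\<lambda>p. \<exists>n. p = ?x n \<and> True" and ?isz = "\<lambda>p. \<exists>n. p = ?z n \<and> True"
    and ?isy = "\<lambda>p. \<exists>n. p = ?y n \<and> True"
  have "bounded_def M (\<lambda>e. ?isx (e 0) \<or> ?isz (e 0) \<or> ?isy (e 0))"
    by (intro bounded_def_disj bounded_def_ex_fst bounded_def_const)
  then obtain X where X: "X \<in> Sets M" "\<And>p. p \<in> X \<longleftrightarrow> ?isx p \<or> ?isz p \<or> ?isy p"
    by (rule bounded_comprehension1) (rule that)
  let ?J = "\<lambda>n x. n = \<zero> \<or> ?isx x"
  have "bounded_def M (\<lambda>e. ?J (e (Suc 0)) (e 0))"
    by (intro bounded_def_disj bounded_def_ex_fst bounded_def_const bounded_def_eq term_intros)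
  then obtain J where J: "J \<in> Sets M" "\<And>n x. pair_code M n x \<in> J \<longleftrightarrow> ?J n x"
    by (rule bounded_relation[of ?J]) (rule that)
  have "bounded_def M (\<lambda>e. in_vicinity T (e i) (e k) (e x))" for i k x
    unfolding in_vicinity_def
    by (intro bounded_def_ex_fst bounded_intros term_intros T)
  then obtain S where S: "S \<in> Sets M"
    "\<And>i k x. pair_code M (pair_code M i k) x \<in> S \<longleftrightarrow> in_vicinity T i k x"
    by (rule bounded_relation3[of "in_vicinity T"]) (rule that)
  let ?\<pi> = "\<lambda>p v. (?isx p \<or> ?isz p) \<and> v = \<zero> \<or> ?isy p \<and> v = \<one>"
  have "bounded_def M (\<lambda>e. ?\<pi> (e (Suc 0)) (e 0))"
    by (intro bounded_def_disj bounded_def_conj bounded_def_ex_fst bounded_def_const bounded_def_eq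
        term_intros)
  then obtain \<pi> where \<pi>: "\<pi> \<in> Sets M" "\<And>z. z \<in> \<pi> \<longleftrightarrow> (\<exists>p v. z = pair_code M p v \<and> ?\<pi> p v)"
    "\<And>p v. pair_code M p v \<in> \<pi> \<longleftrightarrow> ?\<pi> p v"
    by (rule bounded_relation[of ?\<pi>]) (rule that)
  have vic: "seq_term M (seq_term M S x) k = {i. in_vicinity T i k x}" for k x
    by (auto simp: seq_term_def S)
  have J_x: "seq_term M J (?x n) = UNIV" and J_z: "seq_term M J (?z n) = {\<zero>}"
    and J_y: "seq_term M J (?y n) = {\<zero>}" for n
    by (auto simp: seq_term_def J pair_code_inject tags_distinct)
  have X_cases: thesis if "x \<in> X" "\<And>n. x = ?x n \<Longrightarrow> thesis" "\<And>n. x = ?z n \<Longrightarrow> thesis"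
    "\<And>n. x = ?y n \<Longrightarrow> thesis" for x thesis
    using that X by blast
  have in_X: "?x n \<in> X" "?z n \<in> X" "?y n \<in> X" for n using X by blast+
  have app: "fun_app M \<pi> (?x n) = \<zero>" "fun_app M \<pi> (?z n) = \<zero>" "fun_app M \<pi> (?y n) = \<one>" for n
    unfolding fun_app_def by (auto simp: \<pi>(3) pair_code_inject tags_distinct)
  have vic_X: "x \<in> {i. in_vicinity T i k x} \<and> {i. in_vicinity T i k x} \<subseteq> X" if "x \<in> X" for x k
    using that by (rule X_cases; cases rule: disjE[OF zero_or_suc[of k]])
      (auto simp: in_vicinity_simps intro: in_X)
  have z_in_x: "in_vicinity T (?z i) k (?x n) \<longleftrightarrow> i = k" for i k n
    using zero_or_suc[of k] by (auto simp: in_vicinity_simps pair_code_inject tags_distinct)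
  have strong: "strong_V_space M X J S"
    unfolding strong_V_space_def vic
  proof (intro conjI ballI)
    fix x assume "x \<in> X"
    then show "seq_term M J x \<noteq> {}" "initial_segment M (seq_term M J x)"
      by (auto elim!: X_cases simp: J_x J_y J_z initial_segment_def not_less_zero)
    show "x \<in> {i. in_vicinity T i k x}" "{i. in_vicinity T i k x} \<subseteq> X" for k
      using vic_X[OF \<open>x \<in> X\<close>] by blast+
    fix k m assume "k \<in> seq_term M J x" "m \<in> seq_term M J x"
    moreover have "k = m"
      if "{i. in_vicinity T i k (?x n)} = {i. in_vicinity T i m (?x n)}" for n
      using that z_in_x[of k k n] z_in_x[of k m n] by blast
    ultimately show "k \<noteq> m \<longrightarrow> {i. in_vicinity T i k x} \<noteq> {i. in_vicinity T i m x}"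
      using \<open>x \<in> X\<close> by (auto elim!: X_cases simp: J_y J_z)
  qed (use X(1) J(1) S(1) in_X(1) in auto)
  have weak: "weak_V_space M X S"
    unfolding weak_V_space_def vic using X(1) S(1) in_X(1) vic_X by blast
  have same: "weak_vicinities M S x = strong_vicinities M J S x" if "x \<in> X" for x
    unfolding weak_vicinities_def strong_vicinities_def vic
    using that by (rule X_cases) (auto simp: J_x J_y J_z in_vicinity_simps)
  have pi_function: "is_function M \<pi> X UNIV"
    unfolding is_function_def
  proof (intro conjI ballI)
    fix z assume "z \<in> \<pi>"
    then show "\<exists>x\<in>X. \<exists>y\<in>UNIV. z = pair_code M x y" using \<pi>(2) X(2) by blast
  next
    fix x assume "x \<in> X"
    then show "\<exists>!y. pair_code M x y \<in> \<pi>"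
      by (rule X_cases) (auto simp: \<pi>(3) pair_code_inject tags_distinct)
  qed (rule \<pi>(1))
  have const: "\<exists>U\<in>strong_vicinities M J S x. is_constant_on M \<pi> U" if "x \<in> X" for x
  proof -
    have "\<exists>k\<in>seq_term M J x. is_constant_on M \<pi> {i. in_vicinity T i k x}"
      using that
    proof (rule X_cases)
      fix n assume x: "x = ?x n"
      show ?thesis
      proof (cases "\<exists>m. pair_code M n m \<in> T")
        case True
        then obtain m where "pair_code M n m \<in> T" by blast
        then have "is_constant_on M \<pi> {i. in_vicinity T i (m \<oplus> \<one>) x}"
          by (auto simp: x is_constant_on_def in_vicinity_simps app)
        then show ?thesis using J_x by (auto simp: x)
      next
        case False
        then have "is_constant_on M \<pi> {i. in_vicinity T i \<zero> x}"
          by (auto simp: x is_constant_on_def in_vicinity_simps app)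
        then show ?thesis using J_x by (auto simp: x)
      qed
    qed (auto simp: J_y J_z is_constant_on_def in_vicinity_simps app)
    then show ?thesis unfolding strong_vicinities_def vic by blast
  qed
  have proj: "\<exists>Z\<in>Sets M. \<forall>n. n \<in> Z \<longleftrightarrow> (\<exists>m. pair_code M n m \<in> T)"
    if not_connected: "\<not> V_connected M X (strong_vicinities M J S) (?z \<zero>) (?y \<zero>)"
  proof -
    obtain V where cover: "V_cover M X (strong_vicinities M J S) V"
      and "\<not> (\<exists>k \<sigma>. finite_seq M \<sigma> (k \<oplus> \<one>) X \<and> ?z \<zero> = fun_app M \<sigma> \<zero> \<and> ?y \<zero> = fun_app M \<sigma> k \<and>
        (\<forall>j. j \<prec> k \<longrightarrow> seq_term M V (fun_app M \<sigma> j) \<inter> seq_term M V (fun_app M \<sigma> (j \<oplus> \<one>)) \<noteq> {}))"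
      using not_connected unfolding V_connected_def by blast
    then have no_chain: "seq_term M V (?z \<zero>) \<inter> seq_term M V x = {} \<or>
        seq_term M V x \<inter> seq_term M V (?y \<zero>) = {}" if "x \<in> X" for x
      using chain_of_three[OF in_X(2) that in_X(3)] by blast
    have V: "\<exists>k\<in>seq_term M J x. seq_term M V x = {i. in_vicinity T i k x}" if "x \<in> X" for x
      using cover that unfolding V_cover_def strong_vicinities_def vic by blast
    have "seq_term M V (?z \<zero>) = {i. \<exists>m. i = ?x m \<or> i = ?z m}"
      and "seq_term M V (?y \<zero>) = {i. \<exists>m. i = ?y m}"
      using V[OF in_X(2)[of \<zero>]] V[OF in_X(3)[of \<zero>]] by (auto simp: in_vicinity_simps)
    moreover have "?x n \<in> seq_term M V (?x n)" for n
      using V[OF in_X(1)[of n]] vic_X[OF in_X(1)] by blast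
    \<comment> \<open>The cover's vicinity of \<open>x\<^sub>n\<close> meets that of
      \<open>z\<^sub>0\<close> in \<open>x\<^sub>n\<close> itself, so it must miss that of
      \<open>y\<^sub>0\<close>, which contains every \<open>y\<^sub>m\<close>.\<close>
    ultimately have no_y: "?y m \<notin> seq_term M V (?x n)" for m n
      using no_chain[OF in_X(1)[of n]] by blast
    \<comment> \<open>A cover carries no indices, but \<open>z\<^sub>0\<close> lies in vicinity 0 of
      \<open>x\<^sub>n\<close> and in no other, so this test reveals the guess.\<close>
    have "bounded_def M (\<lambda>e. pair_code M (?z \<zero>) (?x (e 0)) \<notin> V)"
      using cover by (intro bounded_intros term_intros) (simp add: V_cover_def)
    then obtain Z where Z: "Z \<in> Sets M" "\<And>n. n \<in> Z \<longleftrightarrow> pair_code M (?z \<zero>) (?x n) \<notin> V"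
      by (rule bounded_comprehension1) (rule that)
    have "n \<in> Z \<longleftrightarrow> (\<exists>m. pair_code M n m \<in> T)" for n
    proof -
      obtain k where k: "seq_term M V (?x n) = {i. in_vicinity T i k (?x n)}"
        using V[OF in_X(1)[of n]] by blast
      have "n \<in> Z \<longleftrightarrow> ?z \<zero> \<notin> seq_term M V (?x n)" by (simp add: Z seq_term_def)
      also have "\<dots> \<longleftrightarrow> k \<noteq> \<zero>" unfolding k using z_in_x by auto
      also have "\<dots> \<longleftrightarrow> (\<exists>m. pair_code M n m \<in> T)"
      proof (cases "k = \<zero>")
        case True
        then show ?thesis using no_y[of _ n] unfolding k by (auto simp: in_vicinity_simps)
      next
        case False
        then obtain m where m: "k = m \<oplus> \<one>" using zero_or_suc by blast
        have "pair_code M n m \<in> T"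
          using no_y[of \<zero> n] unfolding k m by (simp add: in_vicinity_simps)
        with False show ?thesis by blast
      qed
      finally show ?thesis .
    qed
    with Z(1) show ?thesis by blast
  qed
  show ?thesis
    by (rule that[OF strong weak same pi_function in_X(2) in_X(3) _ const proj])
       (simp_all add: app tags_distinct)
qed

text \<open>Serves as the codomain of \<open>\<pi>\<close>, and as the code of the index sets of a
  weak V-space.\<close>

lemma univ_in_Sets: "UNIV \<in> Sets M"
  by (rule bounded_comprehension1[OF bounded_def_const[of True]]) (metis UNIV_eq_I)

end

section \<open>The equivalences\<close>

theorem theorem2p4:
  fixes M :: "'n L2_structure"
  assumes "RCA0 M"
  shows
    "(ACA0 M \<longleftrightarrow>
       (\<forall>X W Y \<pi> a b.
          weak_V_space M X W \<longrightarrow> Y \<in> Sets M \<longrightarrow> is_function M \<pi> X Y \<longrightarrow> a \<in> X \<longrightarrow> b \<in> X \<longrightarrow>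
          V_connected M X (weak_vicinities M W) a b \<longrightarrow> fun_app M \<pi> a \<noteq> fun_app M \<pi> b \<longrightarrow>
          (\<exists>x\<in>X. \<forall>U\<in>weak_vicinities M W x. \<not> is_constant_on M \<pi> U)))
     \<and>
     (ACA0 M \<longleftrightarrow>
       (\<forall>X J S Y \<pi> a b.
          strong_V_space M X J S \<longrightarrow> Y \<in> Sets M \<longrightarrow> is_function M \<pi> X Y \<longrightarrow> a \<in> X \<longrightarrow> b \<in> X \<longrightarrow>
          V_connected M X (strong_vicinities M J S) a b \<longrightarrow> fun_app M \<pi> a \<noteq> fun_app M \<pi> b \<longrightarrow>
          (\<exists>x\<in>X. \<forall>U\<in>strong_vicinities M J S x. \<not> is_constant_on M \<pi> U)))"
    (is "(_ \<longleftrightarrow> ?weak) \<and> (_ \<longleftrightarrow> ?strong)")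
proof -
  interpret rca0 M by unfold_locales (rule assms)
  have strong: ?strong if "ACA0 M"
  proof (intro allI impI, rule ccontr)
    fix X J S Y \<pi> a b
    assume *: "strong_V_space M X J S" "is_function M \<pi> X Y" "a \<in> X" "b \<in> X"
      "V_connected M X (strong_vicinities M J S) a b" "fun_app M \<pi> a \<noteq> fun_app M \<pi> b"
      "\<not> (\<exists>x\<in>X. \<forall>U\<in>strong_vicinities M J S x. \<not> is_constant_on M \<pi> U)"
    have "fun_app M \<pi> a = fun_app M \<pi> b"
    proof (rule connected_locally_constant[OF ACA0_imp_projection_closed[OF that]])
      show "J \<in> Sets M" "S \<in> Sets M" using *(1) by (auto simp: strong_V_space_def)
      show "x \<in> seq_term M (seq_term M S x) n \<and> seq_term M (seq_term M S x) n \<subseteq> X"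
        if "x \<in> X" "n \<in> seq_term M J x" for x n
        using *(1) that by (auto simp: strong_V_space_def)
    qed (use * in auto)
    with *(6) show False by simp
  qed
  have weak: ?weak if "ACA0 M"
  proof (intro allI impI, rule ccontr)
    fix X W Y \<pi> a b
    assume *: "weak_V_space M X W" "is_function M \<pi> X Y" "a \<in> X" "b \<in> X"
      "V_connected M X (weak_vicinities M W) a b" "fun_app M \<pi> a \<noteq> fun_app M \<pi> b"
      "\<not> (\<exists>x\<in>X. \<forall>U\<in>weak_vicinities M W x. \<not> is_constant_on M \<pi> U)"
    have vic: "weak_vicinities M W = strong_vicinities M UNIV W"
      by (auto simp: fun_eq_iff weak_vicinities_def strong_vicinities_def seq_term_def)
    have "fun_app M \<pi> a = fun_app M \<pi> b"
    proof (rule connected_locally_constant[OF ACA0_imp_projection_closed[OF that] univ_in_Sets])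
      show "W \<in> Sets M" using *(1) by (auto simp: weak_V_space_def)
      show "x \<in> seq_term M (seq_term M W x) n \<and> seq_term M (seq_term M W x) n \<subseteq> X"
        if "x \<in> X" for x n
        using *(1) that by (auto simp: weak_V_space_def)
    qed (use * vic in auto)
    with *(6) show False by simp
  qed
  have reversal: "ACA0 M" if "?weak \<or> ?strong"
  proof (rule projection_closed_imp_ACA0, unfold projection_closed_def, rule ballI)
    fix T assume "T \<in> Sets M"
    then obtain X J S \<pi> a b where
      spaces: "strong_V_space M X J S" "weak_V_space M X S"
      and same: "\<And>x. x \<in> X \<Longrightarrow> weak_vicinities M S x = strong_vicinities M J S x"
      and \<pi>: "is_function M \<pi> X UNIV" "a \<in> X" "b \<in> X" "fun_app M \<pi> a \<noteq> fun_app M \<pi> b"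
      and const: "\<And>x. x \<in> X \<Longrightarrow> \<exists>U\<in>strong_vicinities M J S x. is_constant_on M \<pi> U"
      and proj: "\<not> V_connected M X (strong_vicinities M J S) a b \<Longrightarrow>
        \<exists>Z\<in>Sets M. \<forall>n. n \<in> Z \<longleftrightarrow> (\<exists>m. pair_code M n m \<in> T)"
      by (rule projection_space) (rule that)
    \<comment> \<open>Connectedness sees only the vicinities of points of X, so one refutation
      serves both hypotheses.\<close>
    have "V_connected M X (weak_vicinities M S) a b \<longleftrightarrow>
        V_connected M X (strong_vicinities M J S) a b"
      using same by (simp add: V_connected_def V_cover_def)
    then have "\<not> V_connected M X (strong_vicinities M J S) a b"
      using that spaces univ_in_Sets \<pi> const same by blast
    then show "\<exists>Z\<in>Sets M. \<forall>n. n \<in> Z \<longleftrightarrow> (\<exists>m. pair_code M n m \<in> T)" by (rule proj)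
  qed
  show ?thesis
    by (rule conjI; rule iffI)
       (erule weak, rule reversal, erule disjI1, erule strong, rule reversal, erule disjI2)
qed

end
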